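(* Let $g=3$. If $\mathfrak i=1$, $\sigma_1\in\mathfrak D_0$, $\sigma_2\in\mathfrak D_1$, or $\mathfrak i=2$, $\sigma_1\in\mathfrak D_1$, $\sigma_2\in\mathfrak D_2$ (subsets of $S(3,\mathfrak i)^{open}$), then $\sigma_1$ is not D-equivalent to $\sigma_2$.
   Context: Let $p$ be an odd prime and $K=\mathbb Q(\sqrt{-\Delta})$ ($\Delta>0$ a squarefree integer) an imaginary quadratic field in which $p$ is inert. Put $\mathbb Z_{p^2}=\mathbb Z_p[\sqrt{-\Delta}]$, $\mathbb F_{p^2}=\mathbb F_p[\sqrt{-\Delta}]$; bar denotes the nontrivial automorphism, tilde denotes reduction modulo $p$; for $x=a+b\sqrt{-\Delta}$ put $\operatorname{im}x=b$ (entrywise for matrices). Let $g=3$, $\mathfrak i\in\{1,2\}$, $E=\mathrm{diag}(1_{\mathfrak i},-1_{g-\mathfrak i})$ (i.e. signature $(\mathfrak r,\mathfrak s)=(\mathfrak i,g-\mathfrak i)$). $G_V(\mathbb Z_p)$ is the group of $\mathfrak g=h+k\sqrt{-\Delta}$, $h,k\in M_g(\mathbb Z_p)$, with $\mathfrak gE\bar{\mathfrak g}^t=\lambda E$, $\lambda\in\mathbb Z_p^*$; $\alpha(\mathfrak g)=\begin{pmatrix} h& kE\\ -\Delta Ek& EhE\end{pmatrix}\in GSp_{2g}(\mathbb Z_p)$. $S(g,\mathfrak i)^{open}$ is the set of matrices (diagonal blocks of sizes $\mathfrak i,g-\mathfrak i,\mathfrak i,g-\mathfrak i$) $$\sigma=\begin{pmatrix}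 p&0&0&pC^t\\ -A&1&C&U\\ 0&0&p&pA^t\\ 0&0&0&p^2\end{pmatrix},$$ where $A,C$ are integer $(g-\mathfrak i)\times\mathfrak i$ matrices with entries in a fixed system of residues modulo $p$, and $U$ is an integer $(g-\mathfrak i)\times(g-\mathfrak i)$ matrix with diagonal and upper-triangular entries in a fixed system of residues modulo $p^2$ and $CA^t-AC^t=U-U^t$. For such $\sigma$ put $$\mu_1=\begin{pmatrix}-1&-C^t\sqrt{-\Delta}\\ A+C\sqrt{-\Delta}&-1-U\sqrt{-\Delta}\end{pmatrix},\quad \mu_2=\begin{pmatrix}\sqrt{-\Delta}&-A^t\sqrt{-\Delta}\\ A+C\sqrt{-\Delta}&-1-U\sqrt{-\Delta}\end{pmatrix}.$$ If $\det\tilde\mu_1\ne0$, define $X_1,X_2$ by $\mu_2=\begin{pmatrix}X_1&X_2\\0&1\end{pmatrix}\mu_1$; then $\sigma\in\mathfrak D_j$ iff $\operatorname{rank}\operatorname{im}\tilde X_1=j$ ($0\le j\le\mathfrak i$). If $\det\tilde\mu_1=0$ and $\det\tilde\mu_2\ne0$, $\mathfrak D_j$ is defined in the same way with the roles of $\mu_1,\mu_2$ interchanged. If $\det\tilde\mu_1=\det\tilde\mu_2=0$, then $\sigma\in\mathfrak D_*$. Two elements $\sigma_1,\sigma_2$ are D-equivalent if there exists $\mathfrak g\in G_V(\mathbb Z_p)$ such that $\sigma_1\alpha(\mathfrak g)\sigma_2^{-1}$ has entries in $\mathbb Z_p$ (equivalently lies in $GSp_{2g}(\mathbb Z_p)$).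 *)

theory Defs
  imports
    "HOL-Algebra.Ideal"
    "HOL-Computational_Algebra.Computational_Algebra"
    "Berlekamp_Zassenhaus.Finite_Field"
    "Jordan_Normal_Form.Determinant"
    "Jordan_Normal_Form.Gauss_Jordan_Elimination"
    "Jordan_Normal_Form.DL_Rank"
begin

text \<open>
  The prime p and the positive integer \<open>\<Delta>\<close> are carried by type variables: p is \<open>CARD('p)\<close> for
  \<open>'p :: prime_card\<close>, and \<open>\<Delta>\<close> is \<open>CARD('d)\<close> for \<open>'d :: finite\<close>.  Since every positive integer is
  the cardinality of some finite type, quantifying over \<open>'p\<close> and \<open>'d\<close> amounts to quantifying over
  all primes p and all \<open>\<Delta> > 0\<close>.  The field with p elements is \<open>'p mod_ring\<close>.
\<close>

text \<open>
  The p-adic integers: the inverse limit of the rings \<open>\<int>/p^n\<close>, each residue class being represented by its least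
  nonnegative element.
\<close>

typedef ('p :: prime_card) padic_int =
  "{x :: nat \<Rightarrow> int. \<forall>n. x n \<in> {0..<int CARD('p) ^ n} \<and> x (Suc n) mod int CARD('p) ^ n = x n}"
proof (rule exI[of _ "\<lambda>_. 0"])
  have "0 < CARD('p)" by (simp add: prime_card prime_gt_0_nat)
  then show "(\<lambda>_. 0) \<in> {x :: nat \<Rightarrow> int. \<forall>n. x n \<in> {0..<int CARD('p) ^ n} \<and>
      x (Suc n) mod int CARD('p) ^ n = x n}" by simp
qed

setup_lifting type_definition_padic_int

lemma padic_card_pos: "0 < int CARD('p :: prime_card) ^ n"
  by (simp add: prime_card prime_gt_0_nat)

lemma padic_mod_closed:
  fixes f :: "nat \<Rightarrow> int"
  assumes "\<And>n. f (Suc n) mod int CARD('p :: prime_card) ^ n = f n mod int CARD('p) ^ n"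
  shows "f n mod int CARD('p) ^ n \<in> {0..<int CARD('p) ^ n} \<and>
    (f (Suc n) mod int CARD('p) ^ Suc n) mod int CARD('p) ^ n = f n mod int CARD('p) ^ n"
proof (intro conjI)
  show "f n mod int CARD('p) ^ n \<in> {0..<int CARD('p) ^ n}"
    using padic_card_pos[of n, where 'p = 'p] by simp
  have "int CARD('p) ^ n dvd int CARD('p) ^ Suc n" by simp
  then show "(f (Suc n) mod int CARD('p) ^ Suc n) mod int CARD('p) ^ n = f n mod int CARD('p) ^ n"
    using assms[of n] by (simp only: mod_mod_cancel)
qed

instantiation padic_int :: (prime_card) comm_ring_1
begin

lift_definition zero_padic_int :: "'a padic_int" is "\<lambda>_. 0"
  using padic_card_pos[where 'p = 'a] by simp

lift_definition one_padic_int :: "'a padic_int" is "\<lambda>n. 1 mod int CARD('a) ^ n"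
  by (rule padic_mod_closed) simp

lift_definition plus_padic_int :: "'a padic_int \<Rightarrow> 'a padic_int \<Rightarrow> 'a padic_int"
  is "\<lambda>x y n. (x n + y n) mod int CARD('a) ^ n"
  by (rule padic_mod_closed, metis mod_add_eq)

lift_definition uminus_padic_int :: "'a padic_int \<Rightarrow> 'a padic_int"
  is "\<lambda>x n. (- x n) mod int CARD('a) ^ n"
  by (rule padic_mod_closed, metis mod_minus_eq)

lift_definition minus_padic_int :: "'a padic_int \<Rightarrow> 'a padic_int \<Rightarrow> 'a padic_int"
  is "\<lambda>x y n. (x n - y n) mod int CARD('a) ^ n"
  by (rule padic_mod_closed, metis mod_diff_eq)

lift_definition times_padic_int :: "'a padic_int \<Rightarrow> 'a padic_int \<Rightarrow> 'a padic_int"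
  is "\<lambda>x y n. (x n * y n) mod int CARD('a) ^ n"
  by (rule padic_mod_closed, metis mod_mult_eq)

instance
proof
  fix a b c :: "'a padic_int"
  show "a * b * c = a * (b * c)" by transfer (simp add: fun_eq_iff mod_simps mult.assoc)
  show "a * b = b * a" by transfer (simp add: mult.commute)
  show "1 * a = a" by transfer (auto simp: fun_eq_iff mod_simps)
  show "a + b + c = a + (b + c)" by transfer (simp add: fun_eq_iff mod_simps add.assoc)
  show "a + b = b + a" by transfer (simp add: add.commute)
  show "0 + a = a" by transfer (auto simp: fun_eq_iff)
  show "- a + a = 0" by transfer (simp add: fun_eq_iff mod_simps)
  show "a - b = a + - b" by transfer (simp add: fun_eq_iff mod_simps)
  show "(a + b) * c = a * c + b * c"
    by transfer (simp add: fun_eq_iff mod_simps algebra_simps)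
  show "(0 :: 'a padic_int) \<noteq> 1"
  proof
    assume "(0 :: 'a padic_int) = 1"
    then have "(0 :: int) = 1 mod int CARD('a) ^ 1" by transfer metis
    moreover have "1 < int CARD('a)" using prime_gt_1_nat[OF prime_card[where 'a = 'a]] by simp
    ultimately show False by simp
  qed
qed

end

lemma padic_int_mod:
  assumes "m \<le> n"
  shows "Rep_padic_int (x :: 'p :: prime_card padic_int) n mod int CARD('p) ^ m = Rep_padic_int x m"
  using assms
proof (induction n rule: dec_induct)
  case base
  show ?case using Rep_padic_int[of x] by simp
next
  case (step n)
  have "int CARD('p) ^ m dvd int CARD('p) ^ n" using step.hyps by (simp add: le_imp_power_dvd)
  then have "Rep_padic_int x (Suc n) mod int CARD('p) ^ m
      = (Rep_padic_int x (Suc n) mod int CARD('p) ^ n) mod int CARD('p) ^ m"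
    by (simp add: mod_mod_cancel)
  also have "Rep_padic_int x (Suc n) mod int CARD('p) ^ n = Rep_padic_int x n"
    using Rep_padic_int[of x] by simp
  finally show ?case using step.IH by simp
qed

instance padic_int :: (prime_card) idom
proof
  fix x y :: "'a padic_int"
  let ?p = "int CARD('a)"
  have ex: "\<exists>n. Rep_padic_int z n \<noteq> 0" if "z \<noteq> 0" for z :: "'a padic_int"
    using that by transfer auto
  assume "x \<noteq> 0" "y \<noteq> 0"
  then obtain a b where ab: "Rep_padic_int x a \<noteq> 0" "Rep_padic_int y b \<noteq> 0" using ex by metis
  define u where "u = Rep_padic_int x (a + b)"
  define v where "v = Rep_padic_int y (a + b)"
  have u: "\<not> ?p ^ a dvd u" and v: "\<not> ?p ^ b dvd v"
    using ab by (simp_all add: u_def v_def dvd_eq_mod_eq_0 padic_int_mod)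
  have "prime ?p" using prime_card[where 'a = 'a] by simp
  show "x * y \<noteq> 0"
  proof
    assume "x * y = 0"
    then have "Rep_padic_int (x * y) (a + b) = 0" by (simp add: zero_padic_int.rep_eq)
    then have "?p ^ (a + b) dvd u * v" by (simp add: times_padic_int.rep_eq u_def v_def dvd_eq_mod_eq_0)
    then obtain c d where cd: "c + d = a + b" "?p ^ c dvd u" "?p ^ d dvd v"
      using prime_elem_power_dvd_prod[of ?p "a + b" u v] \<open>prime ?p\<close> by auto
    then have "a \<le> c \<or> b \<le> d" by linarith
    then show False using cd u v by (meson dvd_trans le_imp_power_dvd)
  qed
qed

type_synonym 'p padic = "'p padic_int fract"

definition padic_reduce :: "'p :: prime_card padic_int \<Rightarrow> 'p mod_ring" where
  "padic_reduce x = of_int_mod_ring (Rep_padic_int x 1)"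

text \<open>\<open>Quad a b\<close> stands for \<open>a + b \<surd>(-\<Delta>)\<close>, where \<open>\<Delta> = CARD('d)\<close>.\<close>

datatype ('a, 'd) quad = Quad (re_part: 'a) (im_part: 'a)

instantiation quad :: (comm_ring_1, finite) comm_ring_1
begin

definition "0 = Quad 0 0"
definition "1 = Quad 1 0"
definition "x + y = Quad (re_part x + re_part y) (im_part x + im_part y)"
definition "x - y = Quad (re_part x - re_part y) (im_part x - im_part y)"
definition "- x = Quad (- re_part x) (- im_part x)"
definition times_quad :: "('a, 'b) quad \<Rightarrow> ('a, 'b) quad \<Rightarrow> ('a, 'b) quad" where
  "x * y = Quad (re_part x * re_part y - of_nat CARD('b) * (im_part x * im_part y))
                (re_part x * im_part y + im_part x * re_part y)"

instance
  by standard
    (simp_all add: zero_quad_def one_quad_def plus_quad_def minus_quad_def uminus_quad_def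
      times_quad_def quad.expand algebra_simps)

end

definition quad_conj :: "('a :: comm_ring_1, 'd) quad \<Rightarrow> ('a, 'd) quad" where
  "quad_conj x = Quad (re_part x) (- im_part x)"

definition quad_root :: "('a :: comm_ring_1, 'd) quad" where
  "quad_root = Quad 0 1"

text \<open>With \<open>\<int>\<^sub>p[\<surd>(-\<Delta>)]\<close> represented by \<open>('p padic_int, 'd) quad\<close> and
  \<open>\<F>\<^sub>p[\<surd>(-\<Delta>)]\<close> by \<open>('p mod_ring, 'd) quad\<close>, this is reduction modulo p.\<close>

definition quad_reduce :: "('p :: prime_card padic_int, 'd) quad \<Rightarrow> ('p mod_ring, 'd) quad" where
  "quad_reduce x = Quad (padic_reduce (re_part x)) (padic_reduce (im_part x))"

definition ring_of_integers :: "nat \<Rightarrow> complex ring" where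
  "ring_of_integers \<Delta> =
    \<lparr>carrier = {z. algebraic_int z \<and>
        (\<exists>a b. z = of_rat a + of_rat b * csqrt (- of_nat \<Delta>))},
     monoid.mult = (*), one = 1, ring.zero = 0, add = (+)\<rparr>"

definition inert :: "nat \<Rightarrow> nat \<Rightarrow> bool" where
  "inert p \<Delta> \<longleftrightarrow> primeideal (PIdl\<^bsub>ring_of_integers \<Delta>\<^esub> (of_nat p)) (ring_of_integers \<Delta>)"

definition sig_mat :: "nat \<Rightarrow> nat \<Rightarrow> 'a :: comm_ring_1 mat" where
  "sig_mat g i = four_block_mat (1\<^sub>m i) (0\<^sub>m i (g - i)) (0\<^sub>m (g - i) i) (- 1\<^sub>m (g - i))"

definition G_V :: "nat \<Rightarrow> nat \<Rightarrow> ('p :: prime_card padic_int, 'd :: finite) quad mat set" where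
  "G_V g i = {\<gg> \<in> carrier_mat g g. \<exists>c. c dvd 1 \<and>
     \<gg> * sig_mat g i * transpose_mat (map_mat quad_conj \<gg>) = Quad c 0 \<cdot>\<^sub>m sig_mat g i}"

definition alpha :: "nat \<Rightarrow> nat \<Rightarrow> ('a :: comm_ring_1, 'd :: finite) quad mat \<Rightarrow> 'a mat" where
  "alpha g i \<gg> =
    (let h = map_mat re_part \<gg>; k = map_mat im_part \<gg>; E = sig_mat g i
     in four_block_mat h (k * E) (- of_nat CARD('d) \<cdot>\<^sub>m (E * k)) (E * h * E))"

definition residue_system :: "nat \<Rightarrow> int set \<Rightarrow> bool" where
  "residue_system m R \<longleftrightarrow> bij_betw (\<lambda>x. x mod int m) R {0..<int m}"

definition sigma :: "nat \<Rightarrow> nat \<Rightarrow> nat \<Rightarrow> int mat \<Rightarrow> int mat \<Rightarrow> int mat \<Rightarrow> int mat" where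
  "sigma p g i A C U =
    four_block_mat
      (four_block_mat (int p \<cdot>\<^sub>m 1\<^sub>m i) (0\<^sub>m i (g - i)) (- A) (1\<^sub>m (g - i)))
      (four_block_mat (0\<^sub>m i i) (int p \<cdot>\<^sub>m transpose_mat C) C U)
      (0\<^sub>m g g)
      (four_block_mat (int p \<cdot>\<^sub>m 1\<^sub>m i) (int p \<cdot>\<^sub>m transpose_mat A)
         (0\<^sub>m (g - i) i) ((int p)\<^sup>2 \<cdot>\<^sub>m 1\<^sub>m (g - i)))"

text \<open>\<open>R\<close> and \<open>R2\<close> are the fixed systems of residues modulo \<open>p\<close> and modulo \<open>p\<^sup>2\<close>.\<close>

definition open_params ::
  "int set \<Rightarrow> int set \<Rightarrow> nat \<Rightarrow> nat \<Rightarrow> (int mat \<times> int mat \<times> int mat) set" where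
  "open_params R R2 g i = {(A, C, U).
     A \<in> carrier_mat (g - i) i \<and> elements_mat A \<subseteq> R \<and>
     C \<in> carrier_mat (g - i) i \<and> elements_mat C \<subseteq> R \<and>
     U \<in> carrier_mat (g - i) (g - i) \<and>
     (\<forall>a b. a \<le> b \<and> b < g - i \<longrightarrow> U $$ (a, b) \<in> R2) \<and>
     C * transpose_mat A - A * transpose_mat C = U - transpose_mat U}"

definition S_open :: "nat \<Rightarrow> int set \<Rightarrow> int set \<Rightarrow> nat \<Rightarrow> nat \<Rightarrow> int mat set" where
  "S_open p R R2 g i = {sigma p g i A C U | A C U. (A, C, U) \<in> open_params R R2 g i}"

definition mu1 :: "nat \<Rightarrow> nat \<Rightarrow> int mat \<Rightarrow> int mat \<Rightarrow> int mat \<Rightarrow>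
    ('a :: comm_ring_1, 'd :: finite) quad mat" where
  "mu1 g i A C U =
    (let A' = map_mat of_int A; C' = map_mat of_int C; U' = map_mat of_int U
     in four_block_mat
          (- 1\<^sub>m i) (- (quad_root \<cdot>\<^sub>m transpose_mat C'))
          (A' + quad_root \<cdot>\<^sub>m C') (- 1\<^sub>m (g - i) - quad_root \<cdot>\<^sub>m U'))"

definition mu2 :: "nat \<Rightarrow> nat \<Rightarrow> int mat \<Rightarrow> int mat \<Rightarrow> int mat \<Rightarrow>
    ('a :: comm_ring_1, 'd :: finite) quad mat" where
  "mu2 g i A C U =
    (let A' = map_mat of_int A; C' = map_mat of_int C; U' = map_mat of_int U
     in four_block_mat
          (quad_root \<cdot>\<^sub>m 1\<^sub>m i) (- (quad_root \<cdot>\<^sub>m transpose_mat A'))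
          (A' + quad_root \<cdot>\<^sub>m C') (- 1\<^sub>m (g - i) - quad_root \<cdot>\<^sub>m U'))"

text \<open>
  \<open>quotient_rank g i \<mu> \<nu> j\<close>: the i by i block \<open>X1\<close> determined by
  \<open>\<nu> = (X1 X2; 0 1) \<mu>\<close> has \<open>rank (im X1) = j\<close> modulo p.
  It is used only when \<open>\<mu>\<close> is invertible modulo p, so that \<open>X1\<close> and \<open>X2\<close> are unique.
\<close>

definition quotient_rank :: "nat \<Rightarrow> nat \<Rightarrow>
    ('p :: prime_card padic_int, 'd :: finite) quad mat \<Rightarrow> ('p padic_int, 'd) quad mat \<Rightarrow>
    nat \<Rightarrow> bool" where
  "quotient_rank g i \<mu> \<nu> j \<longleftrightarrow>
    (\<exists>X1 \<in> carrier_mat i i. \<exists>X2 \<in> carrier_mat i (g - i).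
       \<nu> = four_block_mat X1 X2 (0\<^sub>m (g - i) i) (1\<^sub>m (g - i)) * \<mu> \<and>
       vec_space.rank i (map_mat im_part (map_mat quad_reduce X1)) = j)"

definition D_stratum :: "'p :: prime_card itself \<Rightarrow> 'd :: finite itself \<Rightarrow>
    int set \<Rightarrow> int set \<Rightarrow> nat \<Rightarrow> nat \<Rightarrow> nat \<Rightarrow> int mat set" where
  "D_stratum _ _ R R2 g i j =
    {sigma CARD('p) g i A C U | A C U. (A, C, U) \<in> open_params R R2 g i \<and>
       (let m1 = mu1 g i A C U :: ('p padic_int, 'd) quad mat;
            m2 = mu2 g i A C U :: ('p padic_int, 'd) quad mat
        in if det (map_mat quad_reduce m1) \<noteq> 0 then quotient_rank g i m1 m2 j
           else det (map_mat quad_reduce m2) \<noteq> 0 \<and> quotient_rank g i m2 m1 j)}"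

lemma D_stratum_subset_S_open:
  "D_stratum TYPE('p :: prime_card) TYPE('d :: finite) R R2 g i j \<subseteq> S_open CARD('p) R R2 g i"
  unfolding D_stratum_def S_open_def by blast

text \<open>\<open>\<sigma>2\<close> is inverted over the p-adic numbers; for \<open>\<sigma>2\<close> in \<open>S_open\<close> the inverse exists, so
  \<open>the\<close> is applied to a proper value.\<close>

definition D_equivalent :: "'p :: prime_card itself \<Rightarrow> 'd :: finite itself \<Rightarrow>
    nat \<Rightarrow> nat \<Rightarrow> int mat \<Rightarrow> int mat \<Rightarrow> bool" where
  "D_equivalent _ _ g i \<sigma>1 \<sigma>2 \<longleftrightarrow>
    (\<exists>\<gg> \<in> G_V g i :: ('p padic_int, 'd) quad mat set.
       elements_mat ((map_mat of_int \<sigma>1 :: 'p padic mat) * map_mat to_fract (alpha g i \<gg>)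
           * the (mat_inverse (map_mat of_int \<sigma>2)))
         \<subseteq> range to_fract)"

end

theory Submission
  imports Defs
begin

text \<open>
  Write \<open>s = \<surd>(-\<Delta>)\<close>.  Sending a row \<open>(x, y)\<close> to \<open>y E s - x\<close> identifies \<open>\<int>\<^sub>p^(2g)\<close> with
  \<open>\<int>\<^sub>p[s]^g\<close> and turns right multiplication by \<open>alpha(G)\<close> into right multiplication by the conjugate of
  \<open>G\<close> (\<open>alpha_twist\<close>).  So if \<open>\<sigma>1\<close> and \<open>\<sigma>2\<close> are D-equivalent, an element of \<open>GL\<^sub>g(\<int>\<^sub>p[s])\<close> carries
  the image of the row lattice of the one to that of the other (\<open>D_equivalent_imp_unimodular\<close>), and it is
  enough to find an invariant of such \<open>\<int>\<^sub>p\<close>-lattices that separates the strata.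

  The invariant is degeneracy: a lattice is degenerate if some linear form \<open>z\<close>, nonzero modulo p,
  maps it into \<open>p \<int>\<^sub>p + p\<^sup>2 \<int>\<^sub>p[s]\<close>.  It is visibly invariant (\<open>degenerate_lattice_transfer\<close>).

  The rows of \<open>\<sigma>\<close> are sent to p times the upper rows of \<open>mu1\<close>, the common lower rows of \<open>mu1\<close> and
  \<open>mu2\<close>, p times the upper rows of \<open>mu2\<close>, and multiples of \<open>p\<^sup>2\<close> (\<open>sigma_twist\<close>).  Hence \<open>z\<close> makes the
  lattice degenerate exactly if the upper entries of \<open>mu1 z\<close> and \<open>mu2 z\<close> are real modulo p and the
  lower entries lie in \<open>p \<int>\<^sub>p + p\<^sup>2 \<int>\<^sub>p[s]\<close>.  Suppose that \<open>mu1\<close> is invertible modulo p, let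
  \<open>mu2 = (X1 X2; 0 1) mu1\<close>, and take \<open>mu1 z\<close> as coordinates of \<open>z\<close>.  Modulo p its lower part vanishes, its
  upper part is a nonzero real vector \<open>v\<close>, and the upper part of \<open>mu2 z\<close> is \<open>X1 v\<close>.  This is real
  exactly if \<open>v\<close> lies in the kernel of \<open>im X1\<close>.  So the lattice is degenerate if and only if the rank of
  \<open>im X1\<close> modulo p is less than \<open>i\<close> (\<open>quotient_rank_degenerate_iff\<close>).  Degeneracy is symmetric in
  \<open>mu1\<close> and \<open>mu2\<close>, so the same holds with their roles interchanged.  In both cases of the theorem
  \<open>\<sigma>1\<close> therefore gives a degenerate lattice and \<open>\<sigma>2\<close> does not.

  Inertness is used to know that \<open>\<int>\<^sub>p[s]\<close> modulo p has no zero divisors: if \<open>-\<Delta>\<close> were a square modulo p,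
  one of the numbers \<open>(c \<plusminus> s) / p\<close> would be an algebraic integer, which is impossible because p is odd
  and \<open>\<Delta>\<close> is squarefree (\<open>inert_imp_nonresidue\<close>).
\<close>

section \<open>Reduction of p-adic integers modulo p\<close>

abbreviation padic_p :: "'p :: prime_card padic_int" where
  "padic_p \<equiv> of_nat CARD('p)"

abbreviation quad_of :: "'a \<Rightarrow> ('a :: comm_ring_1, 'd :: finite) quad" where
  "quad_of x \<equiv> Quad x 0"

lemma quad_sel [simp]:
  "re_part (0 :: ('a :: comm_ring_1, 'd :: finite) quad) = 0" "im_part (0 :: ('a, 'd) quad) = 0"
  "re_part (1 :: ('a, 'd) quad) = 1" "im_part (1 :: ('a, 'd) quad) = 0"
  "re_part (x + y :: ('a, 'd) quad) = re_part x + re_part y"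
  "im_part (x + y) = im_part x + im_part y"
  "re_part (x - y) = re_part x - re_part y" "im_part (x - y) = im_part x - im_part y"
  "re_part (- x) = - re_part x" "im_part (- x) = - im_part x"
  "re_part (x * y) = re_part x * re_part y - of_nat CARD('d) * (im_part x * im_part y)"
  "im_part (x * y) = re_part x * im_part y + im_part x * re_part y"
  "re_part (quad_conj x) = re_part x" "im_part (quad_conj x) = - im_part x"
  "re_part (quad_root :: ('a, 'd) quad) = 0" "im_part (quad_root :: ('a, 'd) quad) = 1"
  by (simp_all add: zero_quad_def one_quad_def plus_quad_def minus_quad_def uminus_quad_def
      times_quad_def quad_conj_def quad_root_def)

lemma quad_sel_of_nat [simp]:
  "re_part (of_nat n :: ('a :: comm_ring_1, 'd :: finite) quad) = of_nat n"
  "im_part (of_nat n :: ('a, 'd) quad) = 0"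
  by (induction n) auto

lemma quad_sel_of_int [simp]:
  "re_part (of_int n :: ('a :: comm_ring_1, 'd :: finite) quad) = of_int n"
  "im_part (of_int n :: ('a, 'd) quad) = 0"
  by (cases n rule: int_cases2; simp)+

lemma Rep_padic_of_nat: "Rep_padic_int (of_nat m :: 'p :: prime_card padic_int) n = int m mod int CARD('p) ^ n"
  by (induction m) (simp_all add: zero_padic_int.rep_eq one_padic_int.rep_eq plus_padic_int.rep_eq mod_simps)

lemma padic_p_nonzero: "(padic_p :: 'p :: prime_card padic_int) \<noteq> 0"
proof
  have p: "int CARD('p) > 1" using prime_gt_1_nat[OF prime_card[where 'a = 'p]] by simp
  assume "(padic_p :: 'p padic_int) = 0"
  then have "int CARD('p) mod int CARD('p) ^ 2 = 0"
    by (metis Rep_padic_of_nat zero_padic_int.rep_eq)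
  moreover have "int CARD('p) < int CARD('p) ^ 2" using p by (simp add: power2_eq_square)
  ultimately show False using p by simp
qed

lemma of_int_mod_ring_mod: "of_int_mod_ring (x mod int CARD('p)) = (of_int_mod_ring x :: 'p :: finite mod_ring)"
  by transfer simp

lemma comm_ring_hom_padic_reduce: "comm_ring_hom (padic_reduce :: 'p :: prime_card padic_int \<Rightarrow> _)"
  by (unfold_locales,
    simp_all add: padic_reduce_def zero_padic_int.rep_eq one_padic_int.rep_eq
      plus_padic_int.rep_eq times_padic_int.rep_eq of_int_mod_ring_mod, simp_all flip: of_int_of_int_mod_ring)

interpretation padic_reduce: comm_ring_hom padic_reduce
  by (rule comm_ring_hom_padic_reduce)

lemma of_int_mod_ring_zero_iff: "(of_int n :: 'p :: prime_card mod_ring) = 0 \<longleftrightarrow> int CARD('p) dvd n"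
  unfolding of_int_of_int_mod_ring by transfer (simp add: dvd_eq_mod_eq_0)

text \<open>
  The kernel of reduction is generated by p.  If the residue of \<open>x\<close> modulo p vanishes, then all its
  residues are divisible by p, and dividing the residue modulo \<open>p^(n+1)\<close> by p gives the residue
  modulo \<open>p^n\<close> of the quotient; the shift of the index accounts for the lost digit.
\<close>

lemma padic_reduce_eq_0_iff: "padic_reduce x = 0 \<longleftrightarrow> padic_p dvd (x :: 'p :: prime_card padic_int)"
proof
  let ?p = "int CARD('p)"
  assume "padic_reduce x = 0"
  then have "?p dvd Rep_padic_int x 1"
    unfolding padic_reduce_def of_int_of_int_mod_ring[symmetric] of_int_mod_ring_zero_iff .
  then have dvd: "?p dvd Rep_padic_int x (Suc n)" for n
    using padic_int_mod[of 1 "Suc n" x] by (metis One_nat_def dvd_eq_mod_eq_0 le_add1 mod_mod_trivial plus_1_eq_Suc power_one_right)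
  define f where "f n = Rep_padic_int x (Suc n) div ?p" for n
  have p: "?p > 0" by (simp add: prime_card prime_gt_0_nat)
  have f: "Rep_padic_int x (Suc n) = ?p * f n" for n using dvd by (simp add: f_def)
  have "f n \<in> {0..<?p ^ n} \<and> f (Suc n) mod ?p ^ n = f n" for n
  proof -
    have "0 \<le> Rep_padic_int x (Suc n) \<and> Rep_padic_int x (Suc n) < ?p ^ Suc n"
      using Rep_padic_int[of x] unfolding mem_Collect_eq atLeastLessThan_iff by blast
    then have "f n \<in> {0..<?p ^ n}" using p unfolding f by (auto simp: zero_le_mult_iff)
    moreover have "(?p * f (Suc n)) mod (?p * ?p ^ n) = ?p * f n"
      using padic_int_mod[of "Suc n" "Suc (Suc n)" x] f by simp
    then have "f (Suc n) mod ?p ^ n = f n" using p by (simp add: mod_mult_mult1)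
    ultimately show ?thesis by blast
  qed
  then have rep: "Rep_padic_int (Abs_padic_int f :: 'p padic_int) = f" by (subst Abs_padic_int_inverse) auto
  have "x = padic_p * Abs_padic_int f"
  proof (subst Rep_padic_int_inject[symmetric], rule ext)
    fix n
    have "Rep_padic_int x n = Rep_padic_int x (Suc n) mod ?p ^ n" by (simp add: padic_int_mod)
    also have "\<dots> = (?p * f n) mod ?p ^ n" by (simp add: f)
    finally show "Rep_padic_int x n = Rep_padic_int (padic_p * Abs_padic_int f :: 'p padic_int) n"
      by (simp add: times_padic_int.rep_eq Rep_padic_of_nat rep mod_simps)
  qed
  then show "padic_p dvd x" by simp
next
  assume "padic_p dvd x"
  then obtain y where "x = padic_p * y" by blast
  moreover have "padic_reduce (padic_p :: 'p padic_int) = 0"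
    using of_int_mod_ring_zero_iff[of "int CARD('p)", where 'p='p]
    by (simp add: padic_reduce.hom_of_nat)
  ultimately show "padic_reduce x = 0" by (simp add: padic_reduce.hom_mult)
qed

lemma comm_ring_hom_quad_reduce:
  "comm_ring_hom (quad_reduce :: ('p :: prime_card padic_int, 'd :: finite) quad \<Rightarrow> _)"
  by unfold_locales
    (simp_all add: quad_reduce_def quad.expand zero_quad_def one_quad_def plus_quad_def times_quad_def
      padic_reduce.hom_add padic_reduce.hom_minus padic_reduce.hom_mult padic_reduce.hom_of_nat)

interpretation quad_reduce: comm_ring_hom quad_reduce
  by (rule comm_ring_hom_quad_reduce)

section \<open>Inert primes\<close>

text \<open>
  A Gauss lemma argument.  Otherwise \<open>p X^2 + b X + c\<close> is primitive and divides every monic integer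
  polynomial that vanishes at \<open>z\<close>: pseudo-division leaves a remainder of degree at most one with the
  non-real root \<open>z\<close>, hence zero.  As p is a prime element of \<open>\<int>[X]\<close>, the powers of p which
  pseudo-division introduces can be cancelled, so that p divides a leading coefficient 1.
\<close>

lemma algebraic_int_quadratic_imp_dvd:
  fixes z :: complex and b c :: int and p :: nat
  assumes "algebraic_int z" "Im z \<noteq> 0" "prime p"
    and root: "of_nat p * z ^ 2 + of_int b * z + of_int c = 0"
  shows "int p dvd b \<and> int p dvd c"
proof (rule ccontr)
  assume nd: "\<not> ?thesis"
  obtain f where f: "poly (of_int_poly f) z = 0" "lead_coeff f = 1"
    using assms(1) unfolding algebraic_int_altdef_ipoly by blast
  define g where "g = [:c, b, int p:]"
  have p0: "p \<noteq> 0" using assms(3) by auto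
  then have g: "g \<noteq> 0" "lead_coeff g = int p" "degree g = 2" by (simp_all add: g_def)
  obtain q r where qr: "pseudo_divmod f g = (q, r)" by force
  define k where "k = Suc (degree f) - degree g"
  have div: "Polynomial.smult (int p ^ k) f = g * q + r" and deg: "r = 0 \<or> degree r < degree g"
    using pseudo_divmod[OF g(1) qr] g(2) by (auto simp: k_def)
  have gz: "poly (of_int_poly g) z = 0"
    using root p0 by (simp add: g_def of_int_hom.map_poly_pCons_hom algebra_simps power2_eq_square)
  have "poly (of_int_poly (Polynomial.smult (int p ^ k) f)) z = poly (of_int_poly (g * q + r)) z" by (simp only: div)
  then have rz: "poly (of_int_poly r) z = 0"
    by (simp add: of_int_poly_hom.hom_add of_int_poly_hom.hom_mult gz f of_int_hom.map_poly_hom_smult)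
  obtain u v where r: "r = [:u, v:]"
  proof -
    have "degree r < 2" using deg g(3) by auto
    then have "r = [:Polynomial.coeff r 0, Polynomial.coeff r 1:]"
      by (intro poly_eqI) (auto simp: coeff_pCons coeff_eq_0 split: nat.split)
    then show ?thesis using that by blast
  qed
  have uv: "of_int u + of_int v * z = 0" using rz by (simp add: r of_int_hom.map_poly_pCons_hom algebra_simps)
  then have "Im (of_int u + of_int v * z) = 0" by simp
  then have "of_int v * Im z = 0" by simp
  then have "v = 0" using assms(2) by simp
  moreover have "u = 0" using uv \<open>v = 0\<close> by simp
  ultimately have "Polynomial.smult (int p ^ k) f = g * q" using div r by simp
  then have "g * q = [:int p:] ^ k * f" by (simp add: poly_const_pow)
  then have "[:int p:] ^ k dvd g * q" by simp
  moreover have "prime_elem [:int p:]" using assms(3) by (intro lift_prime_elem_poly) simp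
  ultimately obtain i j where ij: "i + j = k" "[:int p:] ^ i dvd g" "[:int p:] ^ j dvd q"
    using prime_elem_power_dvd_prod by metis
  have "i = 0"
  proof (rule ccontr)
    assume "i \<noteq> 0"
    then have "[:int p:] dvd g" using ij(2) by (meson dvd_power dvd_trans not_gr_zero)
    then have "int p dvd Polynomial.coeff g n" for n by (simp add: const_poly_dvd_iff)
    from this[of 0] this[of 1] show False using nd by (simp add: g_def)
  qed
  then have "[:int p:] ^ k dvd q" using ij by simp
  then obtain q' where "q = Polynomial.smult (int p ^ k) q'"
    by (elim dvdE) (simp add: poly_const_pow)
  then have "[:int p:] ^ k * f = [:int p:] ^ k * (g * q')"
    using \<open>Polynomial.smult (int p ^ k) f = g * q\<close> by (simp add: poly_const_pow)
  moreover have "[:int p:] ^ k \<noteq> 0" using p0 by simp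
  ultimately have "f = g * q'" by (metis mult_left_cancel)
  then have "1 = int p * lead_coeff q'" using f(2) g(2) by (metis lead_coeff_mult)
  then have "int p dvd 1" by (metis dvd_triv_left)
  then show False using assms(3) by (auto simp: prime_nat_iff)
qed

text \<open>
  If \<open>c^2 + \<Delta> = p k\<close>, then p divides the product of \<open>c + \<surd>(-\<Delta>)\<close> and \<open>c - \<surd>(-\<Delta>)\<close>, so primality of
  the ideal makes one of the numbers \<open>z = (c \<plusminus> \<surd>(-\<Delta>)) / p\<close> an algebraic integer.  It is a root of
  \<open>p X^2 - 2 c X + k\<close>, so p divides \<open>2 c\<close> and \<open>k\<close>, which forces \<open>p^2\<close> to divide the squarefree
  number \<open>\<Delta>\<close>.
\<close>

lemma inert_imp_nonresidue:
  fixes p \<Delta> :: nat and c :: int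
  assumes "prime p" "odd p" "squarefree \<Delta>" "inert p \<Delta>"
  shows "\<not> int p dvd c ^ 2 + int \<Delta>"
proof
  assume "int p dvd c ^ 2 + int \<Delta>"
  then obtain k where k: "c ^ 2 + int \<Delta> = int p * k" by blast
  define s where "s = csqrt (- of_nat \<Delta>)"
  have s2: "s * s = - of_nat \<Delta>"
    using power2_csqrt[of "- of_nat \<Delta>"] by (simp add: s_def power2_eq_square)
  have D0: "\<Delta> > 0" using assms(3) by (auto intro: Nat.gr0I)
  have ims: "Im s \<noteq> 0"
  proof
    assume "Im s = 0"
    then have "Re s * Re s = - of_nat \<Delta>" using arg_cong[OF s2, of Re] by simp
    moreover have "Re s * Re s \<ge> 0" by simp
    ultimately show False using D0 by simp
  qed
  have p0: "(of_nat p :: complex) \<noteq> 0" using assms(1) by auto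
  define R where "R = ring_of_integers \<Delta>"
  have memI: "of_int c + of_int e * s \<in> carrier R" if e: "e * e = 1" for e :: int
  proof -
    let ?z = "of_int c + of_int e * s :: complex"
    have "(of_int e * of_int e :: complex) = 1" by (metis e of_int_1 of_int_mult)
    then have "poly [:of_int (c ^ 2 + int \<Delta>), of_int (- 2 * c), 1:] ?z = 0"
      using s2 by (simp add: algebra_simps power2_eq_square)
    then have "poly (of_int_poly [:c ^ 2 + int \<Delta>, - 2 * c, 1:]) ?z = 0" by simp
    then have "algebraic_int ?z" unfolding algebraic_int_altdef_ipoly
      by (intro exI[of _ "[:c ^ 2 + int \<Delta>, - 2 * c, 1:]"]) simp
    moreover have "\<exists>a b. ?z = of_rat a + of_rat b * s"
      by (intro exI[of _ "of_int c"] exI[of _ "of_int e"]) simp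
    ultimately show ?thesis by (simp add: R_def ring_of_integers_def s_def)
  qed
  have "\<exists>a b. (of_int k :: complex) = of_rat a + of_rat b * s"
    by (intro exI[of _ "of_int k"] exI[of _ 0]) simp
  then have memk: "of_int k \<in> carrier R"
    by (simp add: R_def ring_of_integers_def s_def int_imp_algebraic_int)
  interpret primeideal "PIdl\<^bsub>R\<^esub> (of_nat p)" R
    using assms(4) by (simp add: inert_def R_def)
  have pidl: "PIdl\<^bsub>R\<^esub> (of_nat p) = {x * of_nat p | x. x \<in> carrier R}"
    by (simp add: cgenideal_def R_def ring_of_integers_def)
  have "(of_int c + of_int 1 * s) \<otimes>\<^bsub>R\<^esub> (of_int c + of_int (-1) * s) = of_int (c ^ 2 + int \<Delta>)"
    by (simp add: R_def ring_of_integers_def algebra_simps s2 power2_eq_square)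
  also have "\<dots> = of_int k * of_nat p" by (simp only: k) simp
  finally have "(of_int c + of_int 1 * s) \<otimes>\<^bsub>R\<^esub> (of_int c + of_int (-1) * s) \<in> PIdl\<^bsub>R\<^esub> (of_nat p)"
    using memk unfolding pidl by blast
  then have "of_int c + of_int 1 * s \<in> PIdl\<^bsub>R\<^esub> (of_nat p) \<or>
      of_int c + of_int (-1) * s \<in> PIdl\<^bsub>R\<^esub> (of_nat p)"
    by (intro I_prime memI) simp_all
  then have "\<exists>e :: int. e * e = 1 \<and> of_int c + of_int e * s \<in> PIdl\<^bsub>R\<^esub> (of_nat p)"
  proof
    assume "of_int c + of_int 1 * s \<in> PIdl\<^bsub>R\<^esub> (of_nat p)"
    then show ?thesis by (intro exI[of _ 1]) simp
  next
    assume "of_int c + of_int (-1) * s \<in> PIdl\<^bsub>R\<^esub> (of_nat p)"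
    then show ?thesis by (intro exI[of _ "-1"]) simp
  qed
  then obtain e :: int where e: "e * e = 1" "of_int c + of_int e * s \<in> PIdl\<^bsub>R\<^esub> (of_nat p)" by blast
  then obtain z where z: "z \<in> carrier R" "of_int c + of_int e * s = z * of_nat p"
    unfolding pidl by blast
  have ai: "algebraic_int z" using z(1) by (auto simp: R_def ring_of_integers_def)
  have e0: "e \<noteq> 0" using e(1) by auto
  have im: "Im z \<noteq> 0"
  proof
    assume "Im z = 0"
    then have "Im (of_int c + of_int e * s) = 0" unfolding z(2) by simp
    then show False using ims e0 by simp
  qed
  have ee: "(of_int e * of_int e :: complex) = 1" by (metis e(1) of_int_1 of_int_mult)
  have kk: "(of_int c * of_int c + of_nat \<Delta> :: complex) = of_nat p * of_int k"
    using arg_cong[OF k, of "of_int :: int \<Rightarrow> complex"] by (simp add: power2_eq_square)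
  have "of_nat p * (of_nat p * z ^ 2 + of_int (- 2 * c) * z + of_int k)
      = (z * of_nat p) * (z * of_nat p) - 2 * of_int c * (z * of_nat p) + of_nat p * of_int k"
    by (simp add: algebra_simps power2_eq_square)
  also have "\<dots> = (of_int e * of_int e) * (s * s) - of_int c * of_int c + of_nat p * of_int k"
    unfolding z(2)[symmetric] by (simp add: algebra_simps)
  also have "\<dots> = 0" unfolding ee s2 kk[symmetric] by simp
  finally have "of_nat p * z ^ 2 + of_int (- 2 * c) * z + of_int k = 0" using p0 by simp
  from algebraic_int_quadratic_imp_dvd[OF ai im assms(1) this]
  have dvd: "int p dvd - 2 * c" "int p dvd k" by auto
  have "coprime (int p) 2" using assms(2) by simp
  then have "int p dvd c" using dvd(1) by (simp add: coprime_dvd_mult_right_iff)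
  then have "int p ^ 2 dvd c ^ 2" by simp
  moreover have "int p ^ 2 dvd c ^ 2 + int \<Delta>" unfolding k using dvd(2) by (simp add: power2_eq_square)
  ultimately have "int p ^ 2 dvd int \<Delta>" by (simp add: dvd_add_right_iff)
  then have "int (p ^ 2) dvd int \<Delta>" by simp
  then have "p ^ 2 dvd \<Delta>" by (simp only: int_dvd_int_iff)
  then have "is_unit p" using assms(3) by (simp add: squarefree_def)
  then show False using assms(1) by (simp add: prime_nat_iff)
qed

section \<open>Conjugation and the norm form\<close>

lemma quad_eq_iff: "x = y \<longleftrightarrow> re_part x = re_part y \<and> im_part x = im_part y"
  by (auto intro: quad.expand)

definition quad_norm :: "('a :: comm_ring_1, 'd :: finite) quad \<Rightarrow> 'a" where
  "quad_norm x = re_part x * re_part x + of_nat CARD('d) * (im_part x * im_part x)"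

lemma quad_conj_mult_self: "quad_conj x * x = quad_of (quad_norm x)"
  by (simp add: quad_eq_iff quad_norm_def algebra_simps)

lemma quad_of_mult: "quad_of c * (x :: ('a :: comm_ring_1, 'd :: finite) quad) = Quad (c * re_part x) (c * im_part x)"
  by (simp add: quad_eq_iff)

lemma comm_ring_hom_quad_of: "comm_ring_hom (quad_of :: 'a :: comm_ring_1 \<Rightarrow> ('a, 'd :: finite) quad)"
  by unfold_locales (simp_all add: quad_eq_iff)

interpretation quad_of: comm_ring_hom quad_of
  by (rule comm_ring_hom_quad_of)

lemma comm_ring_hom_quad_conj:
  "comm_ring_hom (quad_conj :: ('a :: comm_ring_1, 'd :: finite) quad \<Rightarrow> ('a, 'd) quad)"
  by unfold_locales (simp_all add: quad_eq_iff algebra_simps)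

interpretation quad_conj: comm_ring_hom quad_conj
  by (rule comm_ring_hom_quad_conj)

lemma quad_norm_reduce:
  "quad_norm (quad_reduce x) = padic_reduce (quad_norm x)"
  by (simp add: quad_norm_def quad_reduce_def padic_reduce.hom_add padic_reduce.hom_mult padic_reduce.hom_of_nat)

text \<open>
  The ring \<open>('p mod_ring, 'd) quad\<close> is the field with \<open>p^2\<close> elements exactly if its norm form has no
  nontrivial zero.  This predicate is the form in which inertness enters everything below.
\<close>

definition anisotropic_norm :: "'p :: prime_card itself \<Rightarrow> 'd :: finite itself \<Rightarrow> bool" where
  "anisotropic_norm _ _ \<longleftrightarrow> (\<forall>x :: ('p mod_ring, 'd) quad. quad_norm x = 0 \<longrightarrow> x = 0)"

lemma inert_imp_anisotropic_norm:
  assumes "odd CARD('p :: prime_card)" "squarefree CARD('d :: finite)" "inert CARD('p) CARD('d)"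
  shows "anisotropic_norm TYPE('p) TYPE('d)"
  unfolding anisotropic_norm_def
proof (intro allI impI)
  fix x :: "('p mod_ring, 'd) quad"
  assume x: "quad_norm x = 0"
  have im: "im_part x = 0"
  proof (rule ccontr)
    assume im: "im_part x \<noteq> 0"
    define t where "t = re_part x / im_part x"
    have re: "re_part x = t * im_part x" using im by (simp add: t_def)
    have "(t * t + of_nat CARD('d)) * (im_part x * im_part x) = 0"
      using x unfolding quad_norm_def re by (simp add: algebra_simps)
    then have "t * t + of_nat CARD('d) = 0" using im by simp
    moreover have "t = of_int (to_int_mod_ring t)" by (simp add: of_int_of_int_mod_ring)
    ultimately have "(of_int (to_int_mod_ring t ^ 2 + int CARD('d)) :: 'p mod_ring) = 0"
      by (simp add: power2_eq_square)
    then have "int CARD('p) dvd to_int_mod_ring t ^ 2 + int CARD('d)"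
      by (simp only: of_int_mod_ring_zero_iff)
    then show False using inert_imp_nonresidue[OF _ assms] prime_card by blast
  qed
  then have "re_part x = 0" using x by (simp add: quad_norm_def)
  with im show "x = 0" by (simp add: quad_eq_iff)
qed

lemma anisotropic_norm_integral:
  assumes "anisotropic_norm TYPE('p :: prime_card) TYPE('d :: finite)"
    and "(x :: ('p mod_ring, 'd) quad) * y = 0" and "x \<noteq> 0"
  shows "y = 0"
proof -
  have n: "quad_norm x \<noteq> 0" using assms(1,3) by (auto simp: anisotropic_norm_def)
  have "quad_of (quad_norm x) * y = quad_conj x * (x * y)"
    unfolding quad_conj_mult_self[symmetric] by (simp only: mult.assoc)
  also have "\<dots> = 0" by (simp add: assms(2))
  finally show ?thesis using n by (simp add: quad_of_mult quad_eq_iff)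
qed

section \<open>The similitude alpha on twisted vectors\<close>

lemma mat_vec_smult:
  fixes A :: "'a :: comm_ring_1 mat"
  assumes "A \<in> carrier_mat nr nc" "v \<in> carrier_vec nc"
  shows "A *\<^sub>v (c \<cdot>\<^sub>v v) = c \<cdot>\<^sub>v (A *\<^sub>v v)"
  using assms by (intro eq_vecI) auto

lemma smult_mat_vec:
  fixes A :: "'a :: comm_ring_1 mat"
  assumes "A \<in> carrier_mat nr nc" "v \<in> carrier_vec nc"
  shows "(c \<cdot>\<^sub>m A) *\<^sub>v v = c \<cdot>\<^sub>v (A *\<^sub>v v)"
  using assms by (intro eq_vecI) auto

lemma mat_vec_uminus:
  fixes A :: "'a :: comm_ring_1 mat"
  assumes "A \<in> carrier_mat nr nc" "v \<in> carrier_vec nc"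
  shows "A *\<^sub>v (- v) = - (A *\<^sub>v v)"
  using assms by (intro eq_vecI) auto

lemma zero_mat_vec:
  fixes v :: "'a :: comm_ring_1 vec"
  assumes "v \<in> carrier_vec nc"
  shows "0\<^sub>m nr nc *\<^sub>v v = 0\<^sub>v nr"
  using assms by (intro eq_vecI) auto

lemma sig_mat_carrier [simp]: "i \<le> g \<Longrightarrow> sig_mat g i \<in> carrier_mat g g"
  using four_block_carrier_mat[of "1\<^sub>m i :: 'a :: comm_ring_1 mat" i i "- 1\<^sub>m (g - i)" "g - i" "g - i"]
  by (simp add: sig_mat_def)

lemma sig_mat_vec:
  fixes z1 :: "'a :: comm_ring_1 vec"
  assumes "z1 \<in> carrier_vec i" "z2 \<in> carrier_vec (g - i)"
  shows "sig_mat g i *\<^sub>v (z1 @\<^sub>v z2) = z1 @\<^sub>v (- z2)"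
  using assms unfolding sig_mat_def
  by (subst four_block_mat_mult_vec[of _ i i _ "g - i" _ "g - i"]) (auto simp: zero_mat_vec)

lemma sig_mat_sq:
  assumes "i \<le> g"
  shows "sig_mat g i * sig_mat g i = (1\<^sub>m g :: 'a :: comm_ring_1 mat)"
  using assms unfolding sig_mat_def
  by (subst mult_four_block_mat[of _ i i _ "g - i" _ "g - i"]) (auto intro!: eq_matI)

text \<open>
  A row \<open>(x, y)\<close> of length \<open>2 g\<close> corresponds to the row \<open>y E \<surd>(-\<Delta>) - x\<close> of length \<open>g\<close> over the
  quadratic extension.  Its value at the column \<open>z\<close> is the product of \<open>(x, y)\<close> with \<open>twist g i z\<close>, so
  the vectors \<open>S *\<^sub>v twist g i z\<close> describe the image of the row lattice of \<open>S\<close> under this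
  correspondence.
\<close>

definition twist :: "nat \<Rightarrow> nat \<Rightarrow> ('a :: comm_ring_1, 'd :: finite) quad vec \<Rightarrow> ('a, 'd) quad vec" where
  "twist g i z = (- z) @\<^sub>v (quad_root \<cdot>\<^sub>v (sig_mat g i *\<^sub>v z))"

lemma twist_carrier [simp]: "i \<le> g \<Longrightarrow> z \<in> carrier_vec g \<Longrightarrow> twist g i z \<in> carrier_vec (2 * g)"
  by (auto simp: twist_def mult_2 mult_mat_vec_carrier[of _ _ g] intro!: append_carrier_vec)

lemma map_sig_mat: "i \<le> g \<Longrightarrow> map_mat quad_of (sig_mat g i) = sig_mat g i"
  by (intro eq_matI) (auto simp: sig_mat_def quad_eq_iff)

lemma quad_root_sq: "quad_root * (quad_root * x) = - of_nat CARD('d) * (x :: ('a :: comm_ring_1, 'd :: finite) quad)"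
  by (simp add: quad_eq_iff)

lemma map_four_block_mat:
  assumes "A \<in> carrier_mat n1 m1" "B \<in> carrier_mat n1 m2" "C \<in> carrier_mat n2 m1" "D \<in> carrier_mat n2 m2"
  shows "map_mat f (four_block_mat A B C D) =
    four_block_mat (map_mat f A) (map_mat f B) (map_mat f C) (map_mat f D)"
  using assms by (intro eq_matI) auto

lemma (in comm_ring_hom) map_mat_smult: "map_mat hom (c \<cdot>\<^sub>m A) = hom c \<cdot>\<^sub>m map_mat hom A"
  by (intro eq_matI) (auto simp: hom_mult)

lemma alpha_carrier [simp]:
  "i \<le> g \<Longrightarrow> G \<in> carrier_mat g g \<Longrightarrow> alpha g i G \<in> carrier_mat (2 * g) (2 * g)"
  unfolding alpha_def Let_def mult_2
  by (intro four_block_carrier_mat mult_carrier_mat[of _ _ g] map_carrier_mat) auto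

text \<open>
  Under the correspondence of rows, right multiplication by \<open>alpha g i G\<close> becomes right multiplication
  by the conjugate of \<open>G\<close>.  Writing \<open>G = h + k \<surd>(-\<Delta>)\<close>, both sides equal
  \<open>- h z + \<surd>(-\<Delta>) k z\<close> on top of \<open>\<surd>(-\<Delta>) E h z + \<Delta> E k z\<close>, because \<open>E^2 = 1\<close>.
\<close>

lemma alpha_twist:
  fixes G :: "('a :: comm_ring_1, 'd :: finite) quad mat"
  assumes i: "i \<le> g" and G: "G \<in> carrier_mat g g" and z: "z \<in> carrier_vec g"
  shows "map_mat quad_of (alpha g i G) *\<^sub>v twist g i z = twist g i (map_mat quad_conj G *\<^sub>v z)"
proof -
  let ?s = "quad_root :: ('a, 'd) quad"
  define E :: "('a, 'd) quad mat" where "E = sig_mat g i"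
  define h k :: "('a, 'd) quad mat"
    where "h = map_mat quad_of (map_mat re_part G)" and "k = map_mat quad_of (map_mat im_part G)"
  have [simp]: "E \<in> carrier_mat g g" "h \<in> carrier_mat g g" "k \<in> carrier_mat g g" "z \<in> carrier_vec g"
    using i G z by (simp_all add: E_def h_def k_def)
  have a: "map_mat quad_of (alpha g i G) =
    four_block_mat h (k * E) (- of_nat CARD('d) \<cdot>\<^sub>m (E * k)) (E * h * E)"
  proof -
    have "map_mat quad_of (alpha g i G) =
      four_block_mat h (map_mat quad_of (map_mat im_part G * sig_mat g i))
       (map_mat quad_of (- of_nat CARD('d) \<cdot>\<^sub>m (sig_mat g i * map_mat im_part G)))
       (map_mat quad_of (sig_mat g i * map_mat re_part G * sig_mat g i))"
      unfolding alpha_def Let_def h_def using i G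
      by (intro map_four_block_mat[of _ g g _ g _ g]) (auto intro!: mult_carrier_mat[of _ _ g] smult_carrier_mat)
    moreover have "map_mat quad_of (map_mat im_part G * sig_mat g i) = k * E"
      using i G by (simp add: quad_of.mat_hom_mult[of _ g g _ g] map_sig_mat k_def E_def)
    moreover have "map_mat quad_of (- of_nat CARD('d) \<cdot>\<^sub>m (sig_mat g i * map_mat im_part G)) =
        - of_nat CARD('d) \<cdot>\<^sub>m (E * k)"
      using i G by (simp add: quad_of.map_mat_smult quad_of.mat_hom_mult[of _ g g _ g] map_sig_mat k_def E_def
         quad_of.hom_uminus quad_of.hom_of_nat)
    moreover have "map_mat quad_of (sig_mat g i * map_mat re_part G * sig_mat g i) = E * h * E"
      using i G by (simp add: quad_of.mat_hom_mult[of _ g g _ g] mult_carrier_mat[of _ g g _ g] map_sig_mat h_def E_def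
        del: assoc_mult_mat)
    ultimately show ?thesis by simp
  qed
  have c: "map_mat quad_conj G = h - ?s \<cdot>\<^sub>m k"
    using G by (intro eq_matI) (auto simp: h_def k_def quad_eq_iff)
  define x y where "x = h *\<^sub>v z" and "y = k *\<^sub>v z"
  note [simp] = mult_mat_vec_carrier[of _ g g] assoc_mult_mat_vec[of _ g g _ g] mat_vec_smult[of _ g g]
    mult_carrier_mat[of _ g g _ g]
  have [simp]: "x \<in> carrier_vec g" "y \<in> carrier_vec g" by (simp_all add: x_def y_def)
  then have [simp]: "dim_vec x = g" "dim_vec y = g" by (auto dest: carrier_vecD)
  have EE: "E *\<^sub>v (E *\<^sub>v v) = v" if "v \<in> carrier_vec g" for v
    using that sig_mat_sq[OF i, where 'a = "('a, 'd) quad"]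
    by (simp add: E_def i flip: assoc_mult_mat_vec[of _ g g _ g])
  have cz: "map_mat quad_conj G *\<^sub>v z = x - ?s \<cdot>\<^sub>v y"
    by (simp add: c x_def y_def minus_mult_distrib_mat_vec[of _ g g] smult_mat_vec[of _ g g])
  have l1: "h *\<^sub>v (- z) + (k * E) *\<^sub>v (?s \<cdot>\<^sub>v (E *\<^sub>v z)) = - (x - ?s \<cdot>\<^sub>v y)"
  proof -
    have "(k * E) *\<^sub>v (?s \<cdot>\<^sub>v (E *\<^sub>v z)) = ?s \<cdot>\<^sub>v y"
      by (simp add: EE y_def)
    moreover have "h *\<^sub>v (- z) = - x" by (simp add: mat_vec_uminus[of _ g g] x_def)
    ultimately show ?thesis by (intro eq_vecI) simp_all
  qed
  have l2: "(- of_nat CARD('d) \<cdot>\<^sub>m (E * k)) *\<^sub>v (- z) + (E * h * E) *\<^sub>v (?s \<cdot>\<^sub>v (E *\<^sub>v z))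
      = ?s \<cdot>\<^sub>v (E *\<^sub>v (x - ?s \<cdot>\<^sub>v y))"
  proof -
    define x' y' where "x' = E *\<^sub>v x" and "y' = E *\<^sub>v y"
    have [simp]: "x' \<in> carrier_vec g" "y' \<in> carrier_vec g" by (simp_all add: x'_def y'_def)
    then have [simp]: "dim_vec x' = g" "dim_vec y' = g" by (auto dest: carrier_vecD)
    have "(- of_nat CARD('d) \<cdot>\<^sub>m (E * k)) *\<^sub>v (- z) = - (- of_nat CARD('d) \<cdot>\<^sub>v y')"
      by (simp add: smult_mat_vec[of _ g g] mat_vec_uminus[of _ g g] y_def y'_def)
    moreover have "(E * h * E) *\<^sub>v (?s \<cdot>\<^sub>v (E *\<^sub>v z)) = ?s \<cdot>\<^sub>v x'"
      by (simp add: EE x_def x'_def)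
    moreover have "E *\<^sub>v (x - ?s \<cdot>\<^sub>v y) = x' - ?s \<cdot>\<^sub>v y'"
      by (simp add: mult_minus_distrib_mat_vec[of _ g g] x'_def y'_def)
    ultimately show ?thesis
      by (intro eq_vecI) (simp_all add: right_diff_distrib quad_root_sq del: index_mult_mat_vec)
  qed
  have "four_block_mat h (k * E) (- of_nat CARD('d) \<cdot>\<^sub>m (E * k)) (E * h * E) *\<^sub>v (- z @\<^sub>v ?s \<cdot>\<^sub>v (E *\<^sub>v z))
      = (- (x - ?s \<cdot>\<^sub>v y)) @\<^sub>v (?s \<cdot>\<^sub>v (E *\<^sub>v (x - ?s \<cdot>\<^sub>v y)))"
    unfolding l1[symmetric] l2[symmetric]
    by (rule four_block_mat_mult_vec[of _ g g _ g _ g])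
      (simp_all del: assoc_mult_mat assoc_mult_mat_vec)
  then show ?thesis unfolding a cz twist_def E_def[symmetric] .
qed

section \<open>Degenerate lattices\<close>

text \<open>
  Membership in \<open>p \<int>\<^sub>p + p\<^sup>2 \<int>\<^sub>p[\<surd>(-\<Delta>)]\<close>.  This set is a \<open>\<int>\<^sub>p\<close>-module, but it is not closed under
  multiplication by \<open>\<surd>(-\<Delta>)\<close>.
\<close>

definition real_mod_square :: "('p :: prime_card padic_int, 'd :: finite) quad \<Rightarrow> bool" where
  "real_mod_square y \<longleftrightarrow> padic_p dvd re_part y \<and> padic_p ^ 2 dvd im_part y"

lemma real_mod_square_sum:
  "(\<And>j. j \<in> J \<Longrightarrow> real_mod_square (f j)) \<Longrightarrow> real_mod_square (\<Sum>j\<in>J. f j)"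
  by (induction J rule: infinite_finite_induct) (auto simp: real_mod_square_def)

lemma real_mod_square_p:
  "real_mod_square (of_nat CARD('p) * y) \<longleftrightarrow> padic_p dvd im_part (y :: ('p :: prime_card padic_int, 'd :: finite) quad)"
  using padic_p_nonzero[where 'p = 'p] by (simp add: real_mod_square_def power2_eq_square)

lemma real_mod_square_p2:
  "real_mod_square (of_nat (CARD('p)\<^sup>2) * (y :: ('p :: prime_card padic_int, 'd :: finite) quad))"
  by (simp add: real_mod_square_def power2_eq_square mult.assoc)

lemma real_mod_square_mat_vec:
  fixes N :: "'p :: prime_card padic_int mat" and y :: "('p padic_int, 'd :: finite) quad vec"
  assumes N: "N \<in> carrier_mat m n" and y: "y \<in> carrier_vec n"
    and real: "\<And>r. r < n \<Longrightarrow> real_mod_square (y $ r)" and r: "r < m"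
  shows "real_mod_square ((map_mat quad_of N *\<^sub>v y) $ r)"
proof -
  have "(map_mat quad_of N *\<^sub>v y) $ r = (\<Sum>j<n. quad_of (N $$ (r, j)) * y $ j)"
    using N y r by (auto simp: scalar_prod_def lessThan_atLeast0)
  moreover have "real_mod_square (quad_of (N $$ (r, j)) * y $ j)" if "j < n" for j
    using real[OF that] by (auto simp: real_mod_square_def)
  ultimately show ?thesis by (auto intro!: real_mod_square_sum)
qed

definition primitive_vec :: "('p :: prime_card padic_int, 'd :: finite) quad vec \<Rightarrow> bool" where
  "primitive_vec z \<longleftrightarrow> (\<exists>r<dim_vec z. quad_reduce (z $ r) \<noteq> 0)"

lemma primitive_vec_mat_vec:
  fixes H :: "('p :: prime_card padic_int, 'd :: finite) quad mat"
  assumes "H \<in> carrier_mat m n" "z \<in> carrier_vec n" "primitive_vec (H *\<^sub>v z)"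
  shows "primitive_vec z"
proof (rule ccontr)
  assume "\<not> primitive_vec z"
  then have 0: "quad_reduce (z $ j) = 0" if "j < n" for j
    using that assms(2) by (auto simp: primitive_vec_def)
  obtain r where r: "r < m" "quad_reduce ((H *\<^sub>v z) $ r) \<noteq> 0"
    using assms(1,3) by (auto simp: primitive_vec_def)
  have "(H *\<^sub>v z) $ r = (\<Sum>j<n. H $$ (r, j) * z $ j)"
    using assms(1,2) r by (auto simp: scalar_prod_def lessThan_atLeast0)
  then have "quad_reduce ((H *\<^sub>v z) $ r) = 0"
    by (simp add: quad_reduce.hom_sum quad_reduce.hom_mult 0)
  then show False using r by simp
qed

text \<open>
  The invariant that separates the strata: some primitive linear form \<open>z\<close> maps the whole row lattice
  of \<open>S\<close> into \<open>p \<int>\<^sub>p + p\<^sup>2 \<int>\<^sub>p[\<surd>(-\<Delta>)]\<close>.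
\<close>

definition degenerate_lattice ::
  "'d :: finite itself \<Rightarrow> nat \<Rightarrow> nat \<Rightarrow> 'p :: prime_card padic_int mat \<Rightarrow> bool" where
  "degenerate_lattice _ g i S \<longleftrightarrow>
    (\<exists>z :: ('p padic_int, 'd) quad vec. z \<in> carrier_vec g \<and> primitive_vec z \<and>
       (\<forall>r < 2 * g. real_mod_square ((map_mat quad_of S *\<^sub>v twist g i z) $ r)))"

text \<open>
  The form \<open>z\<close> for \<open>S\<close> is carried to the form \<open>conj(G') z\<close>; since \<open>conj(G)\<close> maps it back to \<open>z\<close>, it is
  again primitive.  The integral matrix \<open>N\<close> only takes \<open>\<int>\<^sub>p\<close>-linear combinations of values.
\<close>

lemma degenerate_lattice_transfer:
  fixes G G' :: "('p :: prime_card padic_int, 'd :: finite) quad mat"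
  assumes i: "i \<le> g" and G: "G \<in> carrier_mat g g" "G' \<in> carrier_mat g g" "G * G' = 1\<^sub>m g"
    and N: "N \<in> carrier_mat (2 * g) (2 * g)" and S: "S \<in> carrier_mat (2 * g) (2 * g)"
    and deg: "degenerate_lattice TYPE('d) g i S"
  shows "degenerate_lattice TYPE('d) g i (N * S * alpha g i G)"
proof -
  obtain z :: "('p padic_int, 'd) quad vec" where z: "z \<in> carrier_vec g" "primitive_vec z"
    and real: "\<And>r. r < 2 * g \<Longrightarrow> real_mod_square ((map_mat quad_of S *\<^sub>v twist g i z) $ r)"
    using deg unfolding degenerate_lattice_def by blast
  let ?c = "map_mat (quad_conj :: ('p padic_int, 'd) quad \<Rightarrow> _)"
  define z' where "z' = ?c G' *\<^sub>v z"
  have z': "z' \<in> carrier_vec g" using G z by (simp add: z'_def mult_mat_vec_carrier[of _ g g])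
  have "?c G * ?c G' = 1\<^sub>m g"
    using G by (simp add: quad_conj.mat_hom_one flip: quad_conj.mat_hom_mult[of _ g g _ g])
  then have Gz: "?c G *\<^sub>v z' = z"
    using G z by (simp add: z'_def flip: assoc_mult_mat_vec[of _ g g _ g])
  then have prim: "primitive_vec z'"
    using primitive_vec_mat_vec[of "?c G" g g z'] G z z' by simp
  let ?q = "map_mat (quad_of :: 'p padic_int \<Rightarrow> ('p padic_int, 'd) quad)"
  have a: "alpha g i G \<in> carrier_mat (2 * g) (2 * g)" using i G by simp
  have t: "twist g i z' \<in> carrier_vec (2 * g)" "twist g i z \<in> carrier_vec (2 * g)"
    using i z z' by simp_all
  have "?q (N * S * alpha g i G) *\<^sub>v twist g i z' = (?q N * ?q S * ?q (alpha g i G)) *\<^sub>v twist g i z'"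
    by (simp only: quad_of.mat_hom_mult[OF mult_carrier_mat[OF N S] a] quad_of.mat_hom_mult[OF N S])
  also have "\<dots> = ?q N * ?q S *\<^sub>v (?q (alpha g i G) *\<^sub>v twist g i z')"
    using N S a t by (intro assoc_mult_mat_vec[of _ "2 * g" "2 * g" _ "2 * g"]) auto
  also have "?q (alpha g i G) *\<^sub>v twist g i z' = twist g i z"
    by (simp add: alpha_twist[OF i G(1) z'] Gz)
  also have "?q N * ?q S *\<^sub>v twist g i z = ?q N *\<^sub>v (?q S *\<^sub>v twist g i z)"
    using N S t by (intro assoc_mult_mat_vec[of _ "2 * g" "2 * g" _ "2 * g"]) auto
  finally have eq: "?q (N * S * alpha g i G) *\<^sub>v twist g i z' = ?q N *\<^sub>v (?q S *\<^sub>v twist g i z)" .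
  have "?q S *\<^sub>v twist g i z \<in> carrier_vec (2 * g)"
    using S t by (intro mult_mat_vec_carrier[of _ _ "2 * g"]) auto
  then have "real_mod_square ((?q N *\<^sub>v (?q S *\<^sub>v twist g i z)) $ r)" if "r < 2 * g" for r
    using real_mod_square_mat_vec[OF N _ real that] by blast
  then show ?thesis unfolding degenerate_lattice_def using z' prim eq by auto
qed

section \<open>The row lattice in terms of the matrices mu1 and mu2\<close>

lemma all_append_vec:
  assumes "v \<in> carrier_vec n" "w \<in> carrier_vec m"
  shows "(\<forall>r < n + m. P ((v @\<^sub>v w) $ r)) \<longleftrightarrow> (\<forall>r<n. P (v $ r)) \<and> (\<forall>r<m. P (w $ r))"
proof -
  have "P (v $ r)" if "\<forall>r < n + m. P ((v @\<^sub>v w) $ r)" "r < n" for r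
    using that(1)[rule_format, of r] that(2) assms by auto
  moreover have "P (w $ r)" if "\<forall>r < n + m. P ((v @\<^sub>v w) $ r)" "r < m" for r
    using that(1)[rule_format, of "n + r"] that(2) assms by auto
  moreover have "P ((v @\<^sub>v w) $ r)" if "\<forall>r<n. P (v $ r)" "\<forall>r<m. P (w $ r)" "r < n + m" for r
    using that assms by (cases "r < n") auto
  ultimately show ?thesis by blast
qed

text \<open>
  The products of \<open>mu1\<close> and \<open>mu2\<close> with \<open>z1 @\<^sub>v z2\<close> split into an upper part, which differs for the two
  matrices, and a lower part, which is common to both.
\<close>

definition mu1_top :: "int mat \<Rightarrow> ('a :: comm_ring_1, 'd :: finite) quad vec \<Rightarrow> ('a, 'd) quad vec \<Rightarrow>
    ('a, 'd) quad vec" where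
  "mu1_top C z1 z2 = - z1 - quad_root \<cdot>\<^sub>v (transpose_mat (map_mat of_int C) *\<^sub>v z2)"

definition mu2_top :: "int mat \<Rightarrow> ('a :: comm_ring_1, 'd :: finite) quad vec \<Rightarrow> ('a, 'd) quad vec \<Rightarrow>
    ('a, 'd) quad vec" where
  "mu2_top A z1 z2 =
    quad_root \<cdot>\<^sub>v z1 - quad_root \<cdot>\<^sub>v (transpose_mat (map_mat of_int A) *\<^sub>v z2)"

definition mu_bottom :: "int mat \<Rightarrow> int mat \<Rightarrow> int mat \<Rightarrow>
    ('a :: comm_ring_1, 'd :: finite) quad vec \<Rightarrow> ('a, 'd) quad vec \<Rightarrow> ('a, 'd) quad vec" where
  "mu_bottom A C U z1 z2 =
    (map_mat of_int A *\<^sub>v z1 + quad_root \<cdot>\<^sub>v (map_mat of_int C *\<^sub>v z1))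
     + (- z2 - quad_root \<cdot>\<^sub>v (map_mat of_int U *\<^sub>v z2))"

context
  fixes g i :: nat and A C U :: "int mat" and z1 z2 :: "('a :: comm_ring_1, 'd :: finite) quad vec"
  assumes ig: "i \<le> g" and A: "A \<in> carrier_mat (g - i) i" and C: "C \<in> carrier_mat (g - i) i"
    and U: "U \<in> carrier_mat (g - i) (g - i)"
    and z1: "z1 \<in> carrier_vec i" and z2: "z2 \<in> carrier_vec (g - i)"
begin

lemmas block_rules =
  add_mult_distrib_mat_vec[of _ "g - i" i] minus_mult_distrib_mat_vec[of _ "g - i" "g - i"]
  smult_mat_vec[of _ i i] smult_mat_vec[of _ i "g - i"] smult_mat_vec[of _ "g - i" i]
  smult_mat_vec[of _ "g - i" "g - i"] zero_mat_vec

lemma mu1_vec: "mu1 g i A C U *\<^sub>v (z1 @\<^sub>v z2) = mu1_top C z1 z2 @\<^sub>v mu_bottom A C U z1 z2"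
  unfolding mu1_def Let_def mu1_top_def mu_bottom_def
  using A C U z1 z2
  by (subst four_block_mat_mult_vec[of _ i i _ "g - i" _ "g - i"])
    (auto simp: block_rules intro!: arg_cong2[of _ _ _ _ append_vec] eq_vecI simp del: index_mult_mat_vec)

lemma mu2_vec: "mu2 g i A C U *\<^sub>v (z1 @\<^sub>v z2) = mu2_top A z1 z2 @\<^sub>v mu_bottom A C U z1 z2"
  unfolding mu2_def Let_def mu2_top_def mu_bottom_def
  using A C U z1 z2
  by (subst four_block_mat_mult_vec[of _ i i _ "g - i" _ "g - i"])
    (auto simp: block_rules intro!: arg_cong2[of _ _ _ _ append_vec] eq_vecI simp del: index_mult_mat_vec)

lemma mu_parts_carrier:
  "mu1_top C z1 z2 \<in> carrier_vec i" "mu2_top A z1 z2 \<in> carrier_vec i" "mu_bottom A C U z1 z2 \<in> carrier_vec (g - i)"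
  using A C U z1 z2 unfolding mu1_top_def mu2_top_def mu_bottom_def carrier_vec_def carrier_mat_def
  by auto

text \<open>
  The reason for introducing \<open>mu1\<close> and \<open>mu2\<close>: their rows, scaled by powers of p, span the row lattice
  of \<open>sigma\<close> together with the multiples of \<open>p\<^sup>2\<close> that come from its last block.
\<close>

lemma sigma_twist:
  "map_mat of_int (sigma p g i A C U) *\<^sub>v twist g i (z1 @\<^sub>v z2) =
    (of_nat p \<cdot>\<^sub>v mu1_top C z1 z2 @\<^sub>v mu_bottom A C U z1 z2) @\<^sub>v
    (of_nat p \<cdot>\<^sub>v mu2_top A z1 z2 @\<^sub>v of_nat (p\<^sup>2) \<cdot>\<^sub>v (- (quad_root \<cdot>\<^sub>v z2)))"
proof -
  let ?h = "map_mat of_int :: int mat \<Rightarrow> ('a, 'd) quad mat"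
  let ?s = "quad_root :: ('a, 'd) quad"
  have gi: "i + (g - i) = g" using ig by simp
  define a c x y u where "a = transpose_mat (?h A) *\<^sub>v z2" and "c = transpose_mat (?h C) *\<^sub>v z2"
    and "x = ?h A *\<^sub>v z1" and "y = ?h C *\<^sub>v z1" and "u = ?h U *\<^sub>v z2"
  have dims [simp]: "dim_vec a = i" "dim_vec c = i" "dim_vec x = g - i" "dim_vec y = g - i" "dim_vec u = g - i"
    "dim_vec z1 = i" "dim_vec z2 = g - i"
    using A C U z1 z2 by (auto simp: a_def c_def x_def y_def u_def)
  define T1 T2 T4 :: "('a, 'd) quad mat"
    where "T1 = four_block_mat (of_nat p \<cdot>\<^sub>m 1\<^sub>m i) (0\<^sub>m i (g - i)) (- ?h A) (1\<^sub>m (g - i))"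
      and "T2 = four_block_mat (0\<^sub>m i i) (of_nat p \<cdot>\<^sub>m transpose_mat (?h C)) (?h C) (?h U)"
      and "T4 = four_block_mat (of_nat p \<cdot>\<^sub>m 1\<^sub>m i) (of_nat p \<cdot>\<^sub>m transpose_mat (?h A))
         (0\<^sub>m (g - i) i) (of_nat (p\<^sup>2) \<cdot>\<^sub>m 1\<^sub>m (g - i))"
  have carT: "T1 \<in> carrier_mat g g" "T2 \<in> carrier_mat g g" "T4 \<in> carrier_mat g g"
    using A C U gi unfolding T1_def T2_def T4_def carrier_mat_def by auto
  have sig: "?h (sigma p g i A C U) = four_block_mat T1 T2 (0\<^sub>m g g) T4"
    using A C U ig unfolding sigma_def T1_def T2_def T4_def
    by (intro eq_matI) auto
  have tw: "twist g i (z1 @\<^sub>v z2) = (- z1 @\<^sub>v - z2) @\<^sub>v (?s \<cdot>\<^sub>v z1 @\<^sub>v - (?s \<cdot>\<^sub>v z2))"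
    unfolding twist_def sig_mat_vec[OF z1 z2] by (intro eq_vecI) auto
  have v: "- z1 \<in> carrier_vec i" "- z2 \<in> carrier_vec (g - i)"
    "?s \<cdot>\<^sub>v z1 \<in> carrier_vec i" "- (?s \<cdot>\<^sub>v z2) \<in> carrier_vec (g - i)"
    using z1 z2 by auto
  note V = four_block_mat_mult_vec[of _ i i _ "g - i" _ "g - i"]
  have r1: "T1 *\<^sub>v (- z1 @\<^sub>v - z2) = (- (of_nat p \<cdot>\<^sub>v z1)) @\<^sub>v (x - z2)"
    unfolding T1_def x_def using A z1 z2 v
    by (subst V) (auto simp: block_rules mat_vec_uminus[of _ "g - i" i]
      intro!: arg_cong2[of _ _ _ _ append_vec] eq_vecI simp del: index_mult_mat_vec)
  have r2: "T2 *\<^sub>v (?s \<cdot>\<^sub>v z1 @\<^sub>v - (?s \<cdot>\<^sub>v z2)) = (- (of_nat p \<cdot>\<^sub>v (?s \<cdot>\<^sub>v c))) @\<^sub>v (?s \<cdot>\<^sub>v y - ?s \<cdot>\<^sub>v u)"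
    unfolding T2_def c_def y_def u_def using C U z1 z2 v
    by (subst V) (auto simp: block_rules mat_vec_uminus[of _ _ "g - i"] mat_vec_smult[of _ _ i] mat_vec_smult[of _ _ "g - i"]
      intro!: arg_cong2[of _ _ _ _ append_vec] eq_vecI simp del: index_mult_mat_vec)
  have r4: "T4 *\<^sub>v (?s \<cdot>\<^sub>v z1 @\<^sub>v - (?s \<cdot>\<^sub>v z2)) =
      of_nat p \<cdot>\<^sub>v mu2_top A z1 z2 @\<^sub>v of_nat (p\<^sup>2) \<cdot>\<^sub>v (- (?s \<cdot>\<^sub>v z2))"
    unfolding T4_def mu2_top_def using A z1 z2 v
    by (subst V) (auto simp: block_rules mat_vec_uminus[of _ _ "g - i"] mat_vec_smult[of _ _ i] mat_vec_smult[of _ _ "g - i"]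
      algebra_simps
      intro!: arg_cong2[of _ _ _ _ append_vec] eq_vecI simp del: index_mult_mat_vec)
  have w: "- z1 @\<^sub>v - z2 \<in> carrier_vec g" "?s \<cdot>\<^sub>v z1 @\<^sub>v - (?s \<cdot>\<^sub>v z2) \<in> carrier_vec g"
    using append_carrier_vec[OF v(1,2)] append_carrier_vec[OF v(3,4)] gi by simp_all
  have "four_block_mat T1 T2 (0\<^sub>m g g) T4 *\<^sub>v twist g i (z1 @\<^sub>v z2) =
     (T1 *\<^sub>v (- z1 @\<^sub>v - z2) + T2 *\<^sub>v (?s \<cdot>\<^sub>v z1 @\<^sub>v - (?s \<cdot>\<^sub>v z2))) @\<^sub>v
     (0\<^sub>m g g *\<^sub>v (- z1 @\<^sub>v - z2) + T4 *\<^sub>v (?s \<cdot>\<^sub>v z1 @\<^sub>v - (?s \<cdot>\<^sub>v z2)))"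
    unfolding tw by (rule four_block_mat_mult_vec[of _ g g _ g _ g]) (use carT w in auto)
  also have "T1 *\<^sub>v (- z1 @\<^sub>v - z2) + T2 *\<^sub>v (?s \<cdot>\<^sub>v z1 @\<^sub>v - (?s \<cdot>\<^sub>v z2))
      = of_nat p \<cdot>\<^sub>v mu1_top C z1 z2 @\<^sub>v mu_bottom A C U z1 z2"
    unfolding r1 r2 mu1_top_def mu_bottom_def c_def[symmetric] x_def[symmetric] y_def[symmetric] u_def[symmetric]
    by (intro eq_vecI) (auto simp: algebra_simps)
  also have "0\<^sub>m g g *\<^sub>v (- z1 @\<^sub>v - z2) + T4 *\<^sub>v (?s \<cdot>\<^sub>v z1 @\<^sub>v - (?s \<cdot>\<^sub>v z2)) =
      T4 *\<^sub>v (?s \<cdot>\<^sub>v z1 @\<^sub>v - (?s \<cdot>\<^sub>v z2))"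
    using w carT by (auto simp: zero_mat_vec intro!: left_zero_vec mult_mat_vec_carrier)
  finally show ?thesis unfolding sig r4 .
qed

end

text \<open>
  For \<open>\<mu> = mu1\<close> and \<open>\<nu> = mu2\<close> this is the condition on \<open>z\<close> in \<open>degenerate_lattice\<close>, after cancelling
  the factor p in the rows that carry it.  The condition is symmetric in the two matrices because they
  agree in the rows from \<open>i\<close> on.
\<close>

definition degeneracy_witness :: "nat \<Rightarrow> nat \<Rightarrow> ('p :: prime_card padic_int, 'd :: finite) quad mat \<Rightarrow>
    ('p padic_int, 'd) quad mat \<Rightarrow> ('p padic_int, 'd) quad vec \<Rightarrow> bool" where
  "degeneracy_witness g i \<mu> \<nu> z \<longleftrightarrow> z \<in> carrier_vec g \<and> primitive_vec z \<and>
     (\<forall>r<i. padic_p dvd im_part ((\<mu> *\<^sub>v z) $ r)) \<and> (\<forall>r<i. padic_p dvd im_part ((\<nu> *\<^sub>v z) $ r)) \<and>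
     (\<forall>r < g - i. real_mod_square ((\<mu> *\<^sub>v z) $ (i + r)))"

lemma
  fixes z :: "('p :: prime_card padic_int, 'd :: finite) quad vec"
  assumes "i \<le> g" "A \<in> carrier_mat (g - i) i" "C \<in> carrier_mat (g - i) i" "U \<in> carrier_mat (g - i) (g - i)"
    and z: "z \<in> carrier_vec g"
  shows sigma_twist_real_iff:
    "(\<forall>r < 2 * g. real_mod_square ((map_mat of_int (sigma CARD('p) g i A C U) *\<^sub>v twist g i z) $ r)) \<longleftrightarrow>
     (\<forall>r<i. padic_p dvd im_part ((mu1 g i A C U *\<^sub>v z) $ r)) \<and>
     (\<forall>r<i. padic_p dvd im_part ((mu2 g i A C U *\<^sub>v z) $ r)) \<and>
     (\<forall>r < g - i. real_mod_square ((mu1 g i A C U *\<^sub>v z) $ (i + r)))" (is ?iff)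
    and mu_lower_rows: "r < g - i \<Longrightarrow> (mu1 g i A C U *\<^sub>v z) $ (i + r) = (mu2 g i A C U *\<^sub>v z) $ (i + r)"
proof -
  define z1 z2 where "z1 = vec_first z i" and "z2 = vec_last z (g - i)"
  have zc: "z1 \<in> carrier_vec i" "z2 \<in> carrier_vec (g - i)" by (simp_all add: z1_def z2_def)
  have z12: "z = z1 @\<^sub>v z2" using z assms(1) vec_first_last_append[of z i "g - i"] by (simp add: z1_def z2_def)
  note ctx = assms(1-4) zc
  have p: "mu1_top C z1 z2 \<in> carrier_vec i" "mu2_top A z1 z2 \<in> carrier_vec i"
    "mu_bottom A C U z1 z2 \<in> carrier_vec (g - i)"
    using mu_parts_carrier[OF ctx] by auto
  let ?t = "mu1_top C z1 z2" and ?t' = "mu2_top A z1 z2" and ?b = "mu_bottom A C U z1 z2"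
  let ?p = "of_nat CARD('p) :: ('p padic_int, 'd) quad"
  let ?d = "of_nat (CARD('p)\<^sup>2) \<cdot>\<^sub>v (- (quad_root \<cdot>\<^sub>v z2))"
  have c: "?p \<cdot>\<^sub>v ?t \<in> carrier_vec i" "?p \<cdot>\<^sub>v ?t' \<in> carrier_vec i" "?d \<in> carrier_vec (g - i)" using p zc by auto
  have g2: "2 * g = (i + (g - i)) + (i + (g - i))" using assms(1) by simp
  have d: "real_mod_square (?d $ r)" if "r < g - i" for r
    using that zc real_mod_square_p2[of "- (quad_root * z2 $ r)"] by simp
  show ?iff
    unfolding z12 mu1_vec[OF ctx] mu2_vec[OF ctx] sigma_twist[OF ctx] g2
      all_append_vec[OF append_carrier_vec[OF c(1) p(3)] append_carrier_vec[OF c(2) c(3)]]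
      all_append_vec[OF c(1) p(3)] all_append_vec[OF c(2) c(3)]
    using p d by (auto simp: real_mod_square_p)
  show "r < g - i \<Longrightarrow> (mu1 g i A C U *\<^sub>v z) $ (i + r) = (mu2 g i A C U *\<^sub>v z) $ (i + r)"
    unfolding z12 mu1_vec[OF ctx] mu2_vec[OF ctx] using p by auto
qed

lemma degenerate_lattice_sigma_iff:
  assumes "i \<le> g" "A \<in> carrier_mat (g - i) i" "C \<in> carrier_mat (g - i) i" "U \<in> carrier_mat (g - i) (g - i)"
  shows "degenerate_lattice TYPE('d :: finite) g i
      (map_mat of_int (sigma CARD('p :: prime_card) g i A C U) :: 'p padic_int mat) \<longleftrightarrow>
    (\<exists>z :: ('p padic_int, 'd) quad vec. degeneracy_witness g i (mu1 g i A C U) (mu2 g i A C U) z)"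
proof -
  have "map_mat quad_of (map_mat of_int S :: 'p padic_int mat) = (map_mat of_int S :: ('p padic_int, 'd) quad mat)" for S
    by (intro eq_matI) (auto simp: quad_eq_iff)
  moreover have "z \<in> carrier_vec g \<and> primitive_vec z \<and>
      (\<forall>r < 2 * g. real_mod_square ((map_mat of_int (sigma CARD('p) g i A C U) *\<^sub>v twist g i z) $ r)) \<longleftrightarrow>
      degeneracy_witness g i (mu1 g i A C U) (mu2 g i A C U) z" for z :: "('p padic_int, 'd) quad vec"
    unfolding degeneracy_witness_def using sigma_twist_real_iff[OF assms, of z] by blast
  ultimately show ?thesis by (simp only: degenerate_lattice_def)
qed

lemma degeneracy_witness_swap:
  assumes "i \<le> g" "A \<in> carrier_mat (g - i) i" "C \<in> carrier_mat (g - i) i" "U \<in> carrier_mat (g - i) (g - i)"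
  shows "degeneracy_witness g i (mu2 g i A C U) (mu1 g i A C U) z \<longleftrightarrow>
    degeneracy_witness g i (mu1 g i A C U) (mu2 g i A C U) z"
  unfolding degeneracy_witness_def using mu_lower_rows[OF assms, of z] by auto

section \<open>Degeneracy and the rank of the quotient block\<close>

lemma im_part_sum: "im_part (\<Sum>j\<in>J. f j :: ('a :: comm_ring_1, 'd :: finite) quad) = (\<Sum>j\<in>J. im_part (f j))"
  by (induction J rule: infinite_finite_induct) auto

lemma im_part_mat_vec_quad_of:
  fixes X :: "('a :: comm_ring_1, 'd :: finite) quad mat"
  assumes "X \<in> carrier_mat n m" "v \<in> carrier_vec m" "r < n"
  shows "im_part ((X *\<^sub>v map_vec quad_of v) $ r) = (map_mat im_part X *\<^sub>v v) $ r"
  using assms by (auto simp: scalar_prod_def im_part_sum intro!: sum.cong)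

context
  fixes g i :: nat and \<mu> \<nu> X1 X2 :: "('p :: prime_card padic_int, 'd :: finite) quad mat"
  assumes ig: "i \<le> g" and \<mu>: "\<mu> \<in> carrier_mat g g"
    and X1: "X1 \<in> carrier_mat i i" and X2: "X2 \<in> carrier_mat i (g - i)"
    and \<nu>: "\<nu> = four_block_mat X1 X2 (0\<^sub>m (g - i) i) (1\<^sub>m (g - i)) * \<mu>"
begin

text \<open>
  If \<open>\<mu> z\<close> is congruent modulo p to a real vector \<open>v\<close> followed by zeros, then the upper part of \<open>\<nu> z\<close> is
  congruent to \<open>X1 v\<close>, whose imaginary part is \<open>im X1\<close> applied to \<open>v\<close>.
\<close>

lemma im_part_quotient_vec:
  fixes z :: "('p padic_int, 'd) quad vec" and v :: "'p mod_ring vec"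
  assumes z: "z \<in> carrier_vec g" and v: "v \<in> carrier_vec i"
    and top: "\<And>r. r < i \<Longrightarrow> quad_reduce ((\<mu> *\<^sub>v z) $ r) = quad_of (v $ r)"
    and bottom: "\<And>r. r < g - i \<Longrightarrow> quad_reduce ((\<mu> *\<^sub>v z) $ (i + r)) = 0"
    and r: "r < i"
  shows "im_part (quad_reduce ((\<nu> *\<^sub>v z) $ r)) =
    (map_mat im_part (map_mat quad_reduce X1) *\<^sub>v v) $ r"
proof -
  define y where "y = \<mu> *\<^sub>v z"
  have y: "y \<in> carrier_vec g" using \<mu> z by (simp add: y_def mult_mat_vec_carrier[of _ g g])
  let ?B = "four_block_mat X1 X2 (0\<^sub>m (g - i) i) (1\<^sub>m (g - i))"
  let ?X1 = "map_mat quad_reduce X1" and ?X2 = "map_mat quad_reduce X2"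
  have B: "?B \<in> carrier_mat g g" using four_block_carrier_mat[OF X1, of "1\<^sub>m (g - i)" "g - i" "g - i"] ig by simp
  have yr: "map_vec quad_reduce y = map_vec quad_of v @\<^sub>v 0\<^sub>v (g - i)"
  proof (rule eq_vecI)
    fix k assume k: "k < dim_vec (map_vec quad_of v @\<^sub>v (0\<^sub>v (g - i) :: ('p mod_ring, 'd) quad vec))"
    then have "k < g" using v ig by auto
    then have "map_vec quad_reduce y $ k = quad_reduce (y $ k)" using y by simp
    also have "\<dots> = (map_vec quad_of v @\<^sub>v 0\<^sub>v (g - i)) $ k"
      using top[of k] bottom[of "k - i"] v \<open>k < g\<close> unfolding y_def[symmetric]
      by (cases "k < i") (auto simp: diff_less_mono)
    finally show "map_vec quad_reduce y $ k = (map_vec quad_of v @\<^sub>v 0\<^sub>v (g - i)) $ k" .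
  qed (use y v ig in auto)
  have "\<nu> *\<^sub>v z = ?B *\<^sub>v y" unfolding \<nu> y_def using B \<mu> z by (intro assoc_mult_mat_vec[of _ g g _ g]) auto
  then have "map_vec quad_reduce (\<nu> *\<^sub>v z) = map_mat quad_reduce ?B *\<^sub>v map_vec quad_reduce y"
    by (simp only: quad_reduce.mult_mat_vec_hom[OF B y])
  also have "map_mat quad_reduce ?B = four_block_mat ?X1 ?X2 (0\<^sub>m (g - i) i) (1\<^sub>m (g - i))"
    by (subst map_four_block_mat[OF X1 X2, of _ "g - i"])
      (auto simp: quad_reduce.mat_hom_one intro!: eq_matI arg_cong2[of _ _ _ _ "four_block_mat _ _"])
  also have "\<dots> *\<^sub>v map_vec quad_reduce y =
      (?X1 *\<^sub>v map_vec quad_of v + ?X2 *\<^sub>v 0\<^sub>v (g - i)) @\<^sub>v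
      (0\<^sub>m (g - i) i *\<^sub>v map_vec quad_of v + 1\<^sub>m (g - i) *\<^sub>v 0\<^sub>v (g - i))"
    unfolding yr using X1 X2 v by (intro four_block_mat_mult_vec[of _ i i _ "g - i" _ "g - i"]) auto
  finally have "map_vec quad_reduce (\<nu> *\<^sub>v z) $ r = (?X1 *\<^sub>v map_vec quad_of v + ?X2 *\<^sub>v 0\<^sub>v (g - i)) $ r"
    using X1 X2 r by simp
  moreover have "?X2 *\<^sub>v 0\<^sub>v (g - i) = 0\<^sub>v i" using X2 by (intro eq_vecI) auto
  moreover have "?X1 *\<^sub>v map_vec quad_of v \<in> carrier_vec i"
    using X1 v by (intro mult_mat_vec_carrier[of _ i i]) auto
  moreover have "dim_vec (\<nu> *\<^sub>v z) = g" unfolding \<nu> using ig X1 by simp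
  ultimately have "quad_reduce ((\<nu> *\<^sub>v z) $ r) = (?X1 *\<^sub>v map_vec quad_of v) $ r"
    using r ig by simp
  then show ?thesis using im_part_mat_vec_quad_of[of ?X1 i i v r] X1 v r by simp
qed

text \<open>
  A kernel vector of \<open>im X1\<close> modulo p is lifted to a real vector, and \<open>z\<close> is chosen such that \<open>\<mu> z\<close> is a
  real multiple of the lift followed by zeros.
\<close>

lemma singular_imp_degeneracy_witness:
  assumes aniso: "anisotropic_norm TYPE('p) TYPE('d)"
    and det: "det (map_mat quad_reduce \<mu>) \<noteq> 0"
    and sing: "det (map_mat im_part (map_mat quad_reduce X1)) = 0"
  shows "\<exists>z. degeneracy_witness g i \<mu> \<nu> z"
proof -
  let ?Y = "map_mat im_part (map_mat quad_reduce X1)"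
  have Y: "?Y \<in> carrier_mat i i" using X1 by simp
  obtain v where v: "v \<in> carrier_vec i" "v \<noteq> 0\<^sub>v i" "?Y *\<^sub>v v = 0\<^sub>v i"
    using sing det_0_iff_vec_prod_zero[OF Y] by blast
  define lift :: "'p mod_ring \<Rightarrow> 'p padic_int" where "lift t = of_int (to_int_mod_ring t)" for t
  have lift: "padic_reduce (lift t) = t" for t
    by (simp add: lift_def padic_reduce.hom_of_int of_int_of_int_mod_ring)
  define w :: "('p padic_int, 'd) quad vec" where "w = map_vec (quad_of \<circ> lift) v @\<^sub>v 0\<^sub>v (g - i)"
  have w: "w \<in> carrier_vec g" using v ig unfolding w_def carrier_vec_def by simp
  define \<delta> where "\<delta> = det \<mu>"
  define n where "n = quad_norm \<delta>"
  \<comment> \<open>The adjugate solves the linear system up to the factor \<open>\<delta>\<close>; the conjugate turns this factor into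
      the norm of \<open>\<delta>\<close>, which is real and nonzero modulo p.\<close>
  define z where "z = quad_conj \<delta> \<cdot>\<^sub>v (adj_mat \<mu> *\<^sub>v w)"
  have adj: "adj_mat \<mu> \<in> carrier_mat g g" "\<mu> * adj_mat \<mu> = \<delta> \<cdot>\<^sub>m 1\<^sub>m g"
    using adj_mat[OF \<mu>] by (simp_all add: \<delta>_def)
  have adjw: "adj_mat \<mu> *\<^sub>v w \<in> carrier_vec g" using adj w by (simp add: mult_mat_vec_carrier[of _ g g])
  then have z: "z \<in> carrier_vec g" by (simp add: z_def)
  have "\<mu> *\<^sub>v z = quad_conj \<delta> \<cdot>\<^sub>v (\<mu> *\<^sub>v (adj_mat \<mu> *\<^sub>v w))"
    unfolding z_def using \<mu> adjw by (rule mat_vec_smult)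
  also have "\<mu> *\<^sub>v (adj_mat \<mu> *\<^sub>v w) = (\<delta> \<cdot>\<^sub>m 1\<^sub>m g) *\<^sub>v w"
    unfolding adj(2)[symmetric] using \<mu> adj(1) w by (intro assoc_mult_mat_vec[symmetric]) auto
  also have "\<dots> = \<delta> \<cdot>\<^sub>v w" using w by (simp add: smult_mat_vec[of _ g g])
  finally have \<mu>z: "\<mu> *\<^sub>v z = quad_of n \<cdot>\<^sub>v w"
    by (simp add: smult_smult_assoc quad_conj_mult_self n_def)
  have top: "(\<mu> *\<^sub>v z) $ r = quad_of (n * lift (v $ r))" if "r < i" for r
    using that v ig unfolding \<mu>z w_def by (simp add: quad_eq_iff)
  have bottom: "(\<mu> *\<^sub>v z) $ (i + r) = 0" if "r < g - i" for r
    using that v ig unfolding \<mu>z w_def by simp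
  have n: "padic_reduce n \<noteq> 0"
  proof
    assume "padic_reduce n = 0"
    then have "quad_norm (quad_reduce \<delta>) = 0" by (simp add: n_def quad_norm_reduce)
    then have "quad_reduce \<delta> = 0" using aniso by (simp add: anisotropic_norm_def)
    then show False using det by (simp add: \<delta>_def quad_reduce.hom_det)
  qed
  have red: "quad_reduce (quad_of (n * lift t) :: ('p padic_int, 'd) quad) = quad_of (padic_reduce n * t)" for t
    by (simp add: quad_reduce_def padic_reduce.hom_mult lift)
  obtain k where k: "k < i" "v $ k \<noteq> 0"
    using v(1,2) by (metis carrier_vecD eq_vecI index_zero_vec(1) index_zero_vec(2))
  have "quad_reduce ((\<mu> *\<^sub>v z) $ k) = quad_of (padic_reduce n * v $ k)" by (simp only: top[OF k(1)] red)
  then have "quad_reduce ((\<mu> *\<^sub>v z) $ k) \<noteq> 0" using n k(2) by (simp add: quad_eq_iff)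
  then have "primitive_vec (\<mu> *\<^sub>v z)"
    unfolding primitive_vec_def using k(1) ig \<mu> by (intro exI[of _ k]) (simp del: index_mult_mat_vec)
  then have prim: "primitive_vec z" by (rule primitive_vec_mat_vec[OF \<mu> z])
  have "im_part (quad_reduce ((\<nu> *\<^sub>v z) $ r)) = 0" if r: "r < i" for r
  proof -
    have "im_part (quad_reduce ((\<nu> *\<^sub>v z) $ r)) = (?Y *\<^sub>v (padic_reduce n \<cdot>\<^sub>v v)) $ r"
      by (rule im_part_quotient_vec[OF z _ _ _ r]) (use v ig top bottom red in auto)
    also have "?Y *\<^sub>v (padic_reduce n \<cdot>\<^sub>v v) = padic_reduce n \<cdot>\<^sub>v (?Y *\<^sub>v v)"
      using Y v(1) by (rule mat_vec_smult)
    finally show ?thesis using v(3) r by simp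
  qed
  then have "degeneracy_witness g i \<mu> \<nu> z"
    unfolding degeneracy_witness_def using z prim top bottom
    by (auto simp: quad_reduce_def padic_reduce_eq_0_iff real_mod_square_def)
  then show ?thesis ..
qed

text \<open>
  Conversely, the upper part of \<open>\<mu> z\<close> is real modulo p and lies in the kernel of \<open>im X1\<close> modulo p.  It is
  nonzero modulo p, since otherwise \<open>\<mu> z\<close> would vanish modulo p, and so would \<open>z\<close>.
\<close>

lemma degeneracy_witness_imp_singular:
  assumes aniso: "anisotropic_norm TYPE('p) TYPE('d)"
    and det: "det (map_mat quad_reduce \<mu>) \<noteq> 0"
    and wit: "degeneracy_witness g i \<mu> \<nu> z"
  shows "det (map_mat im_part (map_mat quad_reduce X1)) = 0"
proof (rule ccontr)
  let ?Y = "map_mat im_part (map_mat quad_reduce X1)"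
  assume ns: "det ?Y \<noteq> 0"
  have Y: "?Y \<in> carrier_mat i i" using X1 by simp
  have z: "z \<in> carrier_vec g" and prim: "primitive_vec z"
    and t1: "r < i \<Longrightarrow> padic_p dvd im_part ((\<mu> *\<^sub>v z) $ r)"
    and t2: "r < i \<Longrightarrow> padic_p dvd im_part ((\<nu> *\<^sub>v z) $ r)"
    and b: "r < g - i \<Longrightarrow> real_mod_square ((\<mu> *\<^sub>v z) $ (i + r))" for r
    using wit unfolding degeneracy_witness_def by auto
  define v where "v = vec i (\<lambda>r. re_part (quad_reduce ((\<mu> *\<^sub>v z) $ r)))"
  have v: "v \<in> carrier_vec i" by (simp add: v_def)
  have top: "quad_reduce ((\<mu> *\<^sub>v z) $ r) = quad_of (v $ r)" if "r < i" for r
    using that t1[OF that] by (simp add: v_def quad_reduce_def padic_reduce_eq_0_iff)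
  have bottom: "quad_reduce ((\<mu> *\<^sub>v z) $ (i + r)) = 0" if "r < g - i" for r
  proof -
    have "padic_p dvd padic_p ^ 2" by (simp add: power2_eq_square)
    then show ?thesis using b[OF that]
      by (auto simp: real_mod_square_def quad_reduce_def quad_eq_iff padic_reduce_eq_0_iff intro: dvd_trans)
  qed
  have "?Y *\<^sub>v v = 0\<^sub>v i"
  proof (rule eq_vecI)
    fix r assume "r < dim_vec (0\<^sub>v i :: 'p mod_ring vec)"
    then have r: "r < i" by simp
    have "(?Y *\<^sub>v v) $ r = im_part (quad_reduce ((\<nu> *\<^sub>v z) $ r))"
      by (rule im_part_quotient_vec[OF z v top bottom r, symmetric])
    also have "\<dots> = 0" using t2[OF r] by (simp add: quad_reduce_def padic_reduce_eq_0_iff)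
    finally show "(?Y *\<^sub>v v) $ r = 0\<^sub>v i $ r" using r by simp
  qed (use Y in auto)
  then have v0: "v = 0\<^sub>v i" using ns v det_0_iff_vec_prod_zero[OF Y] by blast
  let ?m = "map_mat quad_reduce \<mu>" and ?z = "map_vec quad_reduce z"
  have m: "?m \<in> carrier_mat g g" and zc: "?z \<in> carrier_vec g" using \<mu> z by auto
  have zero: "quad_reduce ((\<mu> *\<^sub>v z) $ r) = 0" if "r < g" for r
    using top[of r] bottom[of "r - i"] that by (cases "r < i") (auto simp: v0 quad_eq_iff)
  have "?m *\<^sub>v ?z = map_vec quad_reduce (\<mu> *\<^sub>v z)" by (rule quad_reduce.mult_mat_vec_hom[OF \<mu> z, symmetric])
  also have "\<dots> = 0\<^sub>v g" using zero \<mu> by (intro eq_vecI) auto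
  finally have mz: "?m *\<^sub>v ?z = 0\<^sub>v g" .
  have adj: "adj_mat ?m \<in> carrier_mat g g" "adj_mat ?m * ?m = det ?m \<cdot>\<^sub>m 1\<^sub>m g"
    using adj_mat[OF m] by auto
  have "det ?m \<cdot>\<^sub>v ?z = (adj_mat ?m * ?m) *\<^sub>v ?z"
    unfolding adj(2) using zc by (simp add: smult_mat_vec[of _ g g])
  also have "\<dots> = adj_mat ?m *\<^sub>v (?m *\<^sub>v ?z)" using adj(1) m zc by (rule assoc_mult_mat_vec)
  also have "\<dots> = 0\<^sub>v g" unfolding mz using adj(1) by (intro eq_vecI) auto
  finally have dz: "det ?m \<cdot>\<^sub>v ?z = 0\<^sub>v g" .
  have "quad_reduce (z $ r) = 0" if "r < g" for r
  proof (rule anisotropic_norm_integral[OF aniso _ det])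
    show "det ?m * quad_reduce (z $ r) = 0" using arg_cong[OF dz, of "\<lambda>x. vec_index x r"] that z by simp
  qed
  then show False using prim z by (auto simp: primitive_vec_def)
qed

end

lemma quotient_rank_degenerate_iff:
  fixes \<mu> \<nu> :: "('p :: prime_card padic_int, 'd :: finite) quad mat"
  assumes "i \<le> g" "\<mu> \<in> carrier_mat g g" "anisotropic_norm TYPE('p) TYPE('d)"
    and det: "det (map_mat quad_reduce \<mu>) \<noteq> 0" and rank: "quotient_rank g i \<mu> \<nu> j"
  shows "(\<exists>z. degeneracy_witness g i \<mu> \<nu> z) \<longleftrightarrow> j \<noteq> i"
proof -
  obtain X1 X2 where X: "X1 \<in> carrier_mat i i" "X2 \<in> carrier_mat i (g - i)"
      "\<nu> = four_block_mat X1 X2 (0\<^sub>m (g - i) i) (1\<^sub>m (g - i)) * \<mu>"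
    and j: "vec_space.rank i (map_mat im_part (map_mat quad_reduce X1)) = j"
    using rank unfolding quotient_rank_def by blast
  have "det (map_mat im_part (map_mat quad_reduce X1)) = 0 \<longleftrightarrow> j \<noteq> i"
    using vec_space.det_rank_iff[of "map_mat im_part (map_mat quad_reduce X1)" i] X(1) j by auto
  then show ?thesis
    using singular_imp_degeneracy_witness[OF assms(1,2) X assms(3) det]
      degeneracy_witness_imp_singular[OF assms(1,2) X assms(3) det] by blast
qed

text \<open>
  Since degeneracy is symmetric in \<open>mu1\<close> and \<open>mu2\<close>, the two clauses in the definition of the strata
  are treated alike.
\<close>

lemma D_stratum_degenerate_iff:
  assumes ig: "i \<le> g" and aniso: "anisotropic_norm TYPE('p :: prime_card) TYPE('d :: finite)"
    and \<sigma>: "\<sigma> \<in> D_stratum TYPE('p) TYPE('d) R R2 g i j"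
  shows "degenerate_lattice TYPE('d) g i (map_mat of_int \<sigma> :: 'p padic_int mat) \<longleftrightarrow> j \<noteq> i"
proof -
  obtain A C U where \<sigma>: "\<sigma> = sigma CARD('p) g i A C U" and par: "(A, C, U) \<in> open_params R R2 g i"
    and strat: "let m1 = mu1 g i A C U :: ('p padic_int, 'd) quad mat;
            m2 = mu2 g i A C U :: ('p padic_int, 'd) quad mat
        in if det (map_mat quad_reduce m1) \<noteq> 0 then quotient_rank g i m1 m2 j
           else det (map_mat quad_reduce m2) \<noteq> 0 \<and> quotient_rank g i m2 m1 j"
    using \<sigma> unfolding D_stratum_def by blast
  have c: "A \<in> carrier_mat (g - i) i" "C \<in> carrier_mat (g - i) i" "U \<in> carrier_mat (g - i) (g - i)"
    using par by (auto simp: open_params_def)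
  let ?m1 = "mu1 g i A C U :: ('p padic_int, 'd) quad mat"
  let ?m2 = "mu2 g i A C U :: ('p padic_int, 'd) quad mat"
  have m: "?m1 \<in> carrier_mat g g" "?m2 \<in> carrier_mat g g"
    using c ig unfolding mu1_def mu2_def Let_def carrier_mat_def by auto
  have "(\<exists>z. degeneracy_witness g i ?m1 ?m2 z) \<longleftrightarrow> j \<noteq> i"
  proof (cases "det (map_mat quad_reduce ?m1) \<noteq> 0")
    case True
    then show ?thesis using strat quotient_rank_degenerate_iff[OF ig m(1) aniso True] by (simp add: Let_def)
  next
    case False
    then have "det (map_mat quad_reduce ?m2) \<noteq> 0" "quotient_rank g i ?m2 ?m1 j"
      using strat by (simp_all add: Let_def)
    then show ?thesis
      using quotient_rank_degenerate_iff[OF ig m(2) aniso] degeneracy_witness_swap[OF ig c] by blast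
  qed
  then show ?thesis unfolding \<sigma> degenerate_lattice_sigma_iff[OF ig c] .
qed

section \<open>D-equivalence as an isomorphism of row lattices\<close>

lemma sigma_carrier:
  assumes "i \<le> g" "A \<in> carrier_mat (g - i) i" "C \<in> carrier_mat (g - i) i" "U \<in> carrier_mat (g - i) (g - i)"
  shows "sigma p g i A C U \<in> carrier_mat (2 * g) (2 * g)"
  using assms unfolding sigma_def carrier_mat_def by auto

lemma det_sigma:
  assumes ig: "i \<le> g" and c: "A \<in> carrier_mat (g - i) i" "C \<in> carrier_mat (g - i) i" "U \<in> carrier_mat (g - i) (g - i)"
  shows "det (sigma p g i A C U) = int p ^ (2 * g)"
proof -
  have gi: "i + (g - i) = g" using ig by simp
  let ?P = "int p \<cdot>\<^sub>m 1\<^sub>m i"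
  let ?T1 = "four_block_mat ?P (0\<^sub>m i (g - i)) (- A) (1\<^sub>m (g - i))"
  let ?T2 = "four_block_mat (0\<^sub>m i i) (int p \<cdot>\<^sub>m transpose_mat C) C U"
  let ?T4 = "four_block_mat ?P (int p \<cdot>\<^sub>m transpose_mat A) (0\<^sub>m (g - i) i) ((int p)\<^sup>2 \<cdot>\<^sub>m 1\<^sub>m (g - i))"
  have T: "?T1 \<in> carrier_mat g g" "?T2 \<in> carrier_mat g g" "?T4 \<in> carrier_mat g g"
    using c gi unfolding carrier_mat_def by auto
  have "det (sigma p g i A C U) = det ?T1 * det ?T4"
    unfolding sigma_def by (rule det_four_block_mat_lower_left_zero[OF T(1,2) refl T(3)])
  also have "det ?T1 = det ?P * det (1\<^sub>m (g - i) :: int mat)"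
    using c by (intro det_four_block_mat_upper_right_zero) auto
  also have "det ?T4 = det ?P * det ((int p)\<^sup>2 \<cdot>\<^sub>m 1\<^sub>m (g - i) :: int mat)"
    using c by (intro det_four_block_mat_lower_left_zero) auto
  finally have "det (sigma p g i A C U) = int p ^ (2 * i + 2 * (g - i))"
    by (simp add: det_smult power_add power_mult power2_eq_square power_mult_distrib)
  then show ?thesis using gi by (metis distrib_left)
qed

lemma G_V_right_inverse:
  assumes ig: "i \<le> g" and G: "G \<in> (G_V g i :: ('p :: prime_card padic_int, 'd :: finite) quad mat set)"
  obtains G' where "G' \<in> carrier_mat g g" "G * G' = 1\<^sub>m g"
proof -
  let ?E = "sig_mat g i :: ('p padic_int, 'd) quad mat"
  let ?t = "transpose_mat (map_mat quad_conj G)"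
  obtain c where Gc: "G \<in> carrier_mat g g" and c: "c dvd 1" and eq: "G * ?E * ?t = quad_of c \<cdot>\<^sub>m ?E"
    using G unfolding G_V_def by blast
  obtain e where e: "1 = c * e" using c by blast
  have E: "?E \<in> carrier_mat g g" using ig by simp
  have t: "?t \<in> carrier_mat g g" using Gc by simp
  have EtE: "?E * ?t * ?E \<in> carrier_mat g g" using E t by (intro mult_carrier_mat) auto
  show thesis
  proof (rule that[of "quad_of e \<cdot>\<^sub>m (?E * ?t * ?E)"])
    show "quad_of e \<cdot>\<^sub>m (?E * ?t * ?E) \<in> carrier_mat g g" using EtE by simp
    have "G * (?E * ?t * ?E) = G * ?E * ?t * ?E"
      using Gc E t by (simp add: assoc_mult_mat[of _ g g _ g _ g] mult_carrier_mat[of _ g g _ g])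
    also have "\<dots> = quad_of c \<cdot>\<^sub>m (?E * ?E)" unfolding eq using E by (rule mult_smult_assoc_mat) (rule E)
    also have "?E * ?E = 1\<^sub>m g" by (rule sig_mat_sq[OF ig])
    finally have "G * (quad_of e \<cdot>\<^sub>m (?E * ?t * ?E)) = quad_of e \<cdot>\<^sub>m (quad_of c \<cdot>\<^sub>m 1\<^sub>m g)"
      by (simp only: mult_smult_distrib[OF Gc EtE])
    also have "\<dots> = 1\<^sub>m g"
      using e by (intro eq_matI) (auto simp: quad_eq_iff mult.commute)
    finally show "G * (quad_of e \<cdot>\<^sub>m (?E * ?t * ?E)) = 1\<^sub>m g" .
  qed
qed

lemma im_part_quad_of_mat_vec:
  fixes y :: "('a :: comm_ring_1, 'd :: finite) quad vec"
  assumes "M \<in> carrier_mat n m" "y \<in> carrier_vec m"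
  shows "map_vec im_part (map_mat quad_of M *\<^sub>v y) = M *\<^sub>v map_vec im_part y"
  using assms by (intro eq_vecI) (auto simp: scalar_prod_def im_part_sum intro!: sum.cong)

lemma re_part_quad_of_mat_vec:
  fixes y :: "('a :: comm_ring_1, 'd :: finite) quad vec"
  assumes "M \<in> carrier_mat n m" "y \<in> carrier_vec m"
  shows "map_vec re_part (map_mat quad_of M *\<^sub>v y) = M *\<^sub>v map_vec re_part y"
proof -
  have "re_part (\<Sum>j\<in>J. f j :: ('a, 'd) quad) = (\<Sum>j\<in>J. re_part (f j))" for J :: "nat set" and f
    by (induction J rule: infinite_finite_induct) auto
  then show ?thesis using assms by (intro eq_vecI) (auto simp: scalar_prod_def intro!: sum.cong)
qed

text \<open>
  The imaginary parts of the twisted vectors are all the vectors of length \<open>2 g\<close>.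
\<close>

lemma mat_eq_if_twist_eq:
  fixes M N :: "'a :: comm_ring_1 mat"
  assumes ig: "i \<le> g" and M: "M \<in> carrier_mat n (2 * g)" and N: "N \<in> carrier_mat n (2 * g)"
    and eq: "\<And>z :: ('a, 'd :: finite) quad vec. z \<in> carrier_vec g \<Longrightarrow>
      map_mat quad_of M *\<^sub>v twist g i z = map_mat quad_of N *\<^sub>v twist g i z"
  shows "M = N"
proof -
  have vec: "M *\<^sub>v w = N *\<^sub>v w" if w: "w \<in> carrier_vec (2 * g)" for w
  proof -
    define x where "x = vec_first w g"
    define y where "y = sig_mat g i *\<^sub>v vec_last w g"
    have xy: "x \<in> carrier_vec g" "y \<in> carrier_vec g"
      using ig by (simp_all add: x_def y_def mult_mat_vec_carrier[of _ g g])
    have "sig_mat g i *\<^sub>v y = vec_last w g"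
      using ig sig_mat_sq[OF ig, where 'a = 'a] by (simp add: y_def flip: assoc_mult_mat_vec[of _ g g _ g])
    then have w_eq: "w = x @\<^sub>v (sig_mat g i *\<^sub>v y)"
      using w vec_first_last_append[of w g g] by (simp add: x_def mult_2)
    let ?y = "map_vec quad_of y :: ('a, 'd) quad vec"
    \<comment> \<open>chosen such that \<open>im (- z) = x\<close> and \<open>re z = y\<close>\<close>
    define z :: "('a, 'd) quad vec" where "z = ?y - quad_root \<cdot>\<^sub>v map_vec quad_of x"
    have z: "z \<in> carrier_vec g" using xy by (simp add: z_def)
    have z_im: "map_vec im_part (- z) = x" and z_re: "map_vec re_part z = y"
      using xy by (auto simp: z_def intro!: eq_vecI)
    have E: "(sig_mat g i :: ('a, 'd) quad mat) = map_mat quad_of (sig_mat g i)" by (rule map_sig_mat[OF ig, symmetric])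
    have "map_vec im_part (quad_root \<cdot>\<^sub>v (sig_mat g i *\<^sub>v z)) = map_vec re_part (sig_mat g i *\<^sub>v z)"
      by (intro eq_vecI) auto
    also have "\<dots> = sig_mat g i *\<^sub>v map_vec re_part z"
      unfolding E using z ig by (intro re_part_quad_of_mat_vec[of _ g g]) auto
    finally have bottom: "map_vec im_part (quad_root \<cdot>\<^sub>v (sig_mat g i *\<^sub>v z)) = sig_mat g i *\<^sub>v y"
      by (simp only: z_re)
    have "map_vec im_part (v @\<^sub>v v') = map_vec im_part v @\<^sub>v map_vec im_part v'"
      for v v' :: "('a, 'd) quad vec"
      by (intro eq_vecI) auto
    then have "map_vec im_part (twist g i z) = w" by (simp only: twist_def w_eq z_im bottom)
    then show ?thesis
      using arg_cong[OF eq[OF z], of "map_vec im_part"] ig z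
      by (simp add: im_part_quad_of_mat_vec[OF M] im_part_quad_of_mat_vec[OF N])
  qed
  show ?thesis
  proof (rule mat_col_eqI)
    fix k assume "k < dim_col N"
    then have k: "k < 2 * g" using N by simp
    have "X *\<^sub>v unit_vec (2 * g) k = col X k" if "X \<in> carrier_mat n (2 * g)" for X :: "'a mat"
      using that k by (intro eq_vecI) auto
    then show "col M k = col N k" using vec[of "unit_vec (2 * g) k"] M N by simp
  qed (use M N in auto)
qed

text \<open>
  By the action on twisted vectors, \<open>alpha\<close> is multiplicative on a pair of inverse matrices.
\<close>

lemma det_alpha_dvd_1:
  fixes G G' :: "('a :: comm_ring_1, 'd :: finite) quad mat"
  assumes ig: "i \<le> g" and G: "G \<in> carrier_mat g g" "G' \<in> carrier_mat g g" "G * G' = 1\<^sub>m g"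
  shows "det (alpha g i G) dvd 1"
proof -
  let ?c = "map_mat (quad_conj :: ('a, 'd) quad \<Rightarrow> _)"
  have a: "alpha g i G \<in> carrier_mat (2 * g) (2 * g)" "alpha g i G' \<in> carrier_mat (2 * g) (2 * g)"
    using ig G by simp_all
  have conj: "?c G * ?c G' = 1\<^sub>m g"
    using G by (simp add: quad_conj.mat_hom_one flip: quad_conj.mat_hom_mult[of _ g g _ g])
  have "alpha g i G * alpha g i G' = 1\<^sub>m (2 * g)"
  proof (rule mat_eq_if_twist_eq[OF ig])
    fix z :: "('a, 'd) quad vec" assume z: "z \<in> carrier_vec g"
    have z': "?c G' *\<^sub>v z \<in> carrier_vec g" using G z by (intro mult_mat_vec_carrier) auto
    have "map_mat quad_of (alpha g i G * alpha g i G') *\<^sub>v twist g i z =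
        (map_mat quad_of (alpha g i G) * map_mat quad_of (alpha g i G')) *\<^sub>v twist g i z"
      by (simp only: quad_of.mat_hom_mult[OF a])
    also have "\<dots> = map_mat quad_of (alpha g i G) *\<^sub>v (map_mat quad_of (alpha g i G') *\<^sub>v twist g i z)"
      using a ig z by (intro assoc_mult_mat_vec) auto
    also have "\<dots> = twist g i (?c G *\<^sub>v (?c G' *\<^sub>v z))"
      by (simp only: alpha_twist[OF ig G(2) z] alpha_twist[OF ig G(1) z'])
    also have "?c G *\<^sub>v (?c G' *\<^sub>v z) = (?c G * ?c G') *\<^sub>v z"
      using G z by (intro assoc_mult_mat_vec[symmetric]) auto
    also have "\<dots> = z" using z by (simp add: conj)
    finally show "map_mat quad_of (alpha g i G * alpha g i G') *\<^sub>v twist g i z =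
        map_mat quad_of (1\<^sub>m (2 * g)) *\<^sub>v twist g i z"
      using ig z by (simp add: quad_of.mat_hom_one)
  qed (use a in auto)
  then have "det (alpha g i G) * det (alpha g i G') = 1" using det_mult[OF a] by simp
  then show ?thesis by (metis dvd_triv_left)
qed

lemma exists_padic_mat:
  fixes M :: "'p :: prime_card padic mat"
  assumes "M \<in> carrier_mat n m" "elements_mat M \<subseteq> range to_fract"
  shows "\<exists>N \<in> carrier_mat n m. M = map_mat to_fract N"
proof -
  have "\<forall>r<n. \<forall>k<m. \<exists>x. M $$ (r, k) = to_fract x"
    using assms(2) elements_matI[OF assms(1) _ _ refl] by blast
  then obtain f where f: "\<And>r k. r < n \<Longrightarrow> k < m \<Longrightarrow> M $$ (r, k) = to_fract (f r k)" by metis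
  then have "M = map_mat to_fract (mat n m (\<lambda>(r, k). f r k))"
    using assms(1) by (intro eq_matI) auto
  then show ?thesis by (intro bexI[of _ "mat n m (\<lambda>(r, k). f r k)"]) auto
qed

lemma comm_ring_hom_to_fract: "comm_ring_hom (to_fract :: 'a :: idom \<Rightarrow> 'a fract)"
  by unfold_locales auto

interpretation to_fract: comm_ring_hom to_fract
  by (rule comm_ring_hom_to_fract)

text \<open>
  D-equivalence provides an integral matrix \<open>M\<close> with \<open>M \<sigma>2 = \<sigma>1 alpha(G)\<close>.  The two determinants of
  \<open>\<sigma>1\<close> and \<open>\<sigma>2\<close> are equal and nonzero, so \<open>det M = det (alpha(G))\<close> is a unit, and \<open>N\<close> is the inverse
  of \<open>M\<close>: the two row lattices correspond to each other, and invariants can be carried from \<open>\<sigma>1\<close> to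
  \<open>\<sigma>2\<close>.
\<close>

lemma D_equivalent_imp_unimodular:
  fixes \<sigma>1 \<sigma>2 :: "int mat"
  assumes ig: "i \<le> g" and c: "\<sigma>1 \<in> carrier_mat (2 * g) (2 * g)" "\<sigma>2 \<in> carrier_mat (2 * g) (2 * g)"
    and d: "det \<sigma>1 = int CARD('p :: prime_card) ^ (2 * g)" "det \<sigma>2 = int CARD('p) ^ (2 * g)"
    and equiv: "D_equivalent TYPE('p) TYPE('d :: finite) g i \<sigma>1 \<sigma>2"
  obtains G G' :: "('p :: prime_card padic_int, 'd :: finite) quad mat" and N :: "'p padic_int mat"
  where "G \<in> carrier_mat g g" "G' \<in> carrier_mat g g" "G * G' = 1\<^sub>m g" "N \<in> carrier_mat (2 * g) (2 * g)"
    "map_mat of_int \<sigma>2 = N * map_mat of_int \<sigma>1 * alpha g i G"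
proof -
  let ?n = "2 * g"
  let ?S1 = "map_mat of_int \<sigma>1 :: 'p padic_int mat" and ?S2 = "map_mat of_int \<sigma>2 :: 'p padic_int mat"
  let ?F = "map_mat (to_fract :: 'p padic_int \<Rightarrow> 'p padic)"
  have S: "?S1 \<in> carrier_mat ?n ?n" "?S2 \<in> carrier_mat ?n ?n" using c by auto
  have F: "map_mat of_int T = ?F (map_mat of_int T)" for T :: "int mat"
    by (intro eq_matI) (auto simp: to_fract.hom_of_int)
  have detS: "det ?S1 = padic_p ^ ?n" "det ?S2 = padic_p ^ ?n"
    using d by (simp_all add: of_int_hom.hom_det)
  obtain G :: "('p padic_int, 'd) quad mat" where G: "G \<in> G_V g i"
    and int: "elements_mat (?F ?S1 * ?F (alpha g i G) * the (mat_inverse (?F ?S2))) \<subseteq> range to_fract"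
    using equiv unfolding D_equivalent_def F by blast
  have Gc: "G \<in> carrier_mat g g" using G by (simp add: G_V_def)
  obtain G' where G': "G' \<in> carrier_mat g g" "G * G' = 1\<^sub>m g" using G_V_right_inverse[OF ig G] .
  have a: "alpha g i G \<in> carrier_mat ?n ?n" using ig Gc by simp
  have F2: "?F ?S2 \<in> carrier_mat ?n ?n" using S by simp
  have "det (?F ?S2) \<noteq> 0" by (simp only: to_fract.hom_det detS) (simp add: padic_p_nonzero)
  then have "?F ?S2 \<in> Units (ring_mat TYPE('p padic) ?n ())" by (rule det_non_zero_imp_unit[OF F2])
  then obtain B where B: "mat_inverse (?F ?S2) = Some B" 
    using mat_inverse(1)[OF F2, where b = "()"] by (meson not_None_eq)
  then have B': "B * ?F ?S2 = 1\<^sub>m ?n" "B \<in> carrier_mat ?n ?n" using mat_inverse(2)[OF F2] by auto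
  have Fa: "?F ?S1 * ?F (alpha g i G) \<in> carrier_mat ?n ?n" using S a by (intro mult_carrier_mat) auto
  obtain M where M: "M \<in> carrier_mat ?n ?n" and MF: "?F ?S1 * ?F (alpha g i G) * B = ?F M"
    using exists_padic_mat[of "?F ?S1 * ?F (alpha g i G) * B" ?n ?n] int Fa B' B by (auto intro: mult_carrier_mat)
  have "?F (M * ?S2) = ?F ?S1 * ?F (alpha g i G) * B * ?F ?S2"
    by (simp only: to_fract.mat_hom_mult[OF M S(2)] MF)
  also have "\<dots> = ?F ?S1 * ?F (alpha g i G) * (B * ?F ?S2)" using Fa B'(2) F2 by (rule assoc_mult_mat)
  also have "\<dots> = ?F (?S1 * alpha g i G)"
    by (simp only: B'(1) right_mult_one_mat[OF Fa] to_fract.mat_hom_mult[OF S(1) a])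
  finally have FF: "?F (M * ?S2) = ?F (?S1 * alpha g i G)" .
  have inj: "X = Y" if "?F X = ?F Y" for X Y
  proof (rule eq_matI)
    have dims: "dim_row X = dim_row Y" "dim_col X = dim_col Y"
      using arg_cong[OF that, of dim_row] arg_cong[OF that, of dim_col] by simp_all
    then show "dim_row X = dim_row Y" "dim_col X = dim_col Y" by auto
    fix r k assume "r < dim_row Y" "k < dim_col Y"
    then show "X $$ (r, k) = Y $$ (r, k)" using arg_cong[OF that, of "\<lambda>T. T $$ (r, k)"] dims by simp
  qed
  have eq: "M * ?S2 = ?S1 * alpha g i G" by (rule inj[OF FF])
  have "det M * padic_p ^ ?n = padic_p ^ ?n * det (alpha g i G)"
    using arg_cong[OF eq, of det] by (simp only: det_mult[OF M S(2)] det_mult[OF S(1) a] detS)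
  then have "det M = det (alpha g i G)" using padic_p_nonzero[where 'p = 'p] by simp
  then have "det M dvd 1" using det_alpha_dvd_1[OF ig Gc G'] by simp
  then obtain e where e: "1 = det M * e" by blast
  define N where "N = e \<cdot>\<^sub>m adj_mat M"
  have N: "N \<in> carrier_mat ?n ?n" using adj_mat(1)[OF M] by (simp add: N_def)
  have "N * M = e \<cdot>\<^sub>m (adj_mat M * M)" unfolding N_def using adj_mat(1)[OF M] M by (rule mult_smult_assoc_mat)
  also have "\<dots> = 1\<^sub>m ?n" unfolding adj_mat(3)[OF M] using e by (intro eq_matI) (auto simp: mult.commute)
  finally have NM: "N * M = 1\<^sub>m ?n" .
  have "?S2 = (N * M) * ?S2" using S by (simp add: NM)
  also have "\<dots> = N * (?S1 * alpha g i G)" unfolding eq[symmetric] using N M S(2) by (rule assoc_mult_mat)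
  also have "\<dots> = N * ?S1 * alpha g i G" using N S(1) a by (rule assoc_mult_mat[symmetric])
  finally show ?thesis using that[OF Gc G' N] by blast
qed

text \<open>
  For every \<open>g\<close> and \<open>i\<close>, degeneracy separates the stratum with index \<open>i\<close> from those with smaller index.
\<close>

lemma D_stratum_not_D_equivalent:
  assumes ig: "i \<le> g" and aniso: "anisotropic_norm TYPE('p :: prime_card) TYPE('d :: finite)"
    and \<sigma>1: "\<sigma>1 \<in> D_stratum TYPE('p) TYPE('d) R R2 g i j" and "j \<noteq> i"
    and \<sigma>2: "\<sigma>2 \<in> D_stratum TYPE('p) TYPE('d) R R2 g i i"
  shows "\<not> D_equivalent TYPE('p) TYPE('d) g i \<sigma>1 \<sigma>2"
proof
  assume equiv: "D_equivalent TYPE('p) TYPE('d) g i \<sigma>1 \<sigma>2"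
  have basic: "\<sigma> \<in> carrier_mat (2 * g) (2 * g) \<and> det \<sigma> = int CARD('p) ^ (2 * g)"
    if "\<sigma> \<in> D_stratum TYPE('p) TYPE('d) R R2 g i k" for \<sigma> k
    using that sigma_carrier[OF ig] det_sigma[OF ig] unfolding D_stratum_def open_params_def by auto
  obtain G G' :: "('p padic_int, 'd) quad mat" and N :: "'p padic_int mat"
    where G: "G \<in> carrier_mat g g" "G' \<in> carrier_mat g g" "G * G' = 1\<^sub>m g"
      and N: "N \<in> carrier_mat (2 * g) (2 * g)"
      and eq: "map_mat of_int \<sigma>2 = N * map_mat of_int \<sigma>1 * alpha g i G"
    using D_equivalent_imp_unimodular[OF ig _ _ _ _ equiv] basic[OF \<sigma>1] basic[OF \<sigma>2] by metis
  have "degenerate_lattice TYPE('d) g i (map_mat of_int \<sigma>1 :: 'p padic_int mat)"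
    using D_stratum_degenerate_iff[OF ig aniso \<sigma>1] assms(4) by simp
  then have "degenerate_lattice TYPE('d) g i (map_mat of_int \<sigma>2 :: 'p padic_int mat)"
    unfolding eq using basic[OF \<sigma>1] by (intro degenerate_lattice_transfer[OF ig G N]) auto
  then show False using D_stratum_degenerate_iff[OF ig aniso \<sigma>2] by simp
qed

theorem proposition4p2p16:
  fixes g i :: nat and R R2 :: "int set" and \<sigma>1 \<sigma>2 :: "int mat"
  assumes "odd CARD('p :: prime_card)"
    and "squarefree CARD('d :: finite)"
    and "inert CARD('p) CARD('d)"
    and "residue_system CARD('p) R" and "residue_system (CARD('p)\<^sup>2) R2"
    and "g = 3"
    and "i = 1 \<and> \<sigma>1 \<in> D_stratum TYPE('p) TYPE('d) R R2 g i 0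
               \<and> \<sigma>2 \<in> D_stratum TYPE('p) TYPE('d) R R2 g i 1
       \<or> i = 2 \<and> \<sigma>1 \<in> D_stratum TYPE('p) TYPE('d) R R2 g i 1
               \<and> \<sigma>2 \<in> D_stratum TYPE('p) TYPE('d) R R2 g i 2"
  shows "\<not> D_equivalent TYPE('p) TYPE('d) g i \<sigma>1 \<sigma>2"
proof -
  have aniso: "anisotropic_norm TYPE('p) TYPE('d)"
    by (rule inert_imp_anisotropic_norm[OF assms(1-3)])
  obtain j where "\<sigma>1 \<in> D_stratum TYPE('p) TYPE('d) R R2 g i j" "j \<noteq> i"
      "\<sigma>2 \<in> D_stratum TYPE('p) TYPE('d) R R2 g i i" "i \<le> g"
    using assms(6,7) by auto
  then show ?thesis using D_stratum_not_D_equivalent[OF _ aniso] by blast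
qed

end
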